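(* Let $(\mu_\lambda(dx))_{\lambda>0}$ be a convolution semigroup on $\mathbb{Z}^n$. Let $c\in\mathbb{R}^n$. Denote $$\mu_\lambda(dx)=\sum_{k\in\mathbb{Z}^n}f(\lambda,k)\,\delta_k(dx).$$ Define also $$p_k(\lambda,c)=\frac{\lambda}{\lambda+\langle c,k\rangle}\,f(\lambda+\langle c,k\rangle,k)\,1_{(0,\infty)}(\lambda+\langle c,k\rangle).$$ Then $$p_k(\lambda,c)\,1_{[0,\infty)}(\langle c,k\rangle)=\sum_{k'\in\mathbb{Z}^n}p_{k'}(\lambda,0)\,p_{k-k'}(\langle c,k'\rangle,c).$$
   Context: $\langle\cdot,\cdot\rangle$ is the canonical scalar product of $\mathbb{R}^n$; $\delta_k$ is the Dirac mass at $k$; $1_S$ is the indicator function of the set $S$. A convolution semigroup is a family of positive measures with $\mu_\lambda*\mu_{\lambda'}=\mu_{\lambda+\lambda'}$ for all $\lambda,\lambda'>0$. The formula defining $p_k(\lambda,c)$ is also used when its first argument is a real number such as $\langle c,k'\rangle$, the value being $0$ when the indicator vanishes.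
   Formalization: The formal statement assumes ⟨c,k⟩≠0 (if ⟨c,k⟩=0 the right side is 0 while the left is f(λ,k)) and that the series over k' converges absolutely (for heavy-tailed semigroups it can diverge, leaving the right side undefined). *)

theory Defs
  imports "HOL-Probability.Probability"
begin

text \<open>
  The lattice \<open>\<int>\<^sup>n\<close> is the type \<^typ>\<open>int ^ 'n\<close>, with its discrete \<open>\<sigma>\<close>-algebra.
\<close>

definition inner_lattice :: "real ^ 'n \<Rightarrow> int ^ 'n \<Rightarrow> real"
  where "inner_lattice c k = c \<bullet> (\<chi> i. real_of_int (k $ i))"

text \<open>
  The library convolution is restricted to the class of ordered Euclidean spaces, which does not
  contain \<^typ>\<open>int ^ 'n\<close>.
\<close>

definition lattice_convolution :: "(int ^ 'n) measure \<Rightarrow> (int ^ 'n) measure \<Rightarrow> (int ^ 'n) measure"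
  where "lattice_convolution M N = distr (M \<Otimes>\<^sub>M N) (count_space UNIV) (\<lambda>(x, y). x + y)"

text \<open>
  Points have finite mass, so that the numbers \<open>f(\<lambda>, k)\<close> are real; the total mass may be infinite,
  and no continuity in \<open>\<lambda>\<close> is assumed. The values of \<open>\<mu>\<close> at \<open>\<lambda> \<le> 0\<close> are irrelevant.
\<close>

definition convolution_semigroup :: "(real \<Rightarrow> (int ^ 'n) measure) \<Rightarrow> bool"
  where "convolution_semigroup \<mu> \<longleftrightarrow>
    (\<forall>l>0. sets (\<mu> l) = UNIV \<and> (\<forall>k. emeasure (\<mu> l) {k} < \<infinity>)) \<and>
    (\<forall>l>0. \<forall>l'>0. lattice_convolution (\<mu> l) (\<mu> l') = \<mu> (l + l'))"

definition mass :: "(real \<Rightarrow> (int ^ 'n) measure) \<Rightarrow> real \<Rightarrow> int ^ 'n \<Rightarrow> real"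
  where "mass \<mu> l k = measure (\<mu> l) {k}"

lemma convolution_semigroup_eq_point_measure:
  fixes \<mu> :: "real \<Rightarrow> (int ^ 'n) measure"
  assumes "convolution_semigroup \<mu>" "l > 0"
  shows "\<mu> l = point_measure UNIV (\<lambda>k. ennreal (mass \<mu> l k))"
proof (rule measure_eqI_countable[where A = UNIV])
  fix k :: "int ^ 'n"
  have "emeasure (\<mu> l) {k} < \<infinity>"
    using assms by (auto simp: convolution_semigroup_def)
  then have "emeasure (\<mu> l) {k} = ennreal (mass \<mu> l k)"
    by (simp add: mass_def emeasure_eq_ennreal_measure less_top[symmetric])
  also have "\<dots> = emeasure (point_measure UNIV (\<lambda>k. ennreal (mass \<mu> l k))) {k}"
    by (subst emeasure_point_measure_finite2) auto
  finally show "emeasure (\<mu> l) {k} = emeasure (point_measure UNIV (\<lambda>k. ennreal (mass \<mu> l k))) {k}" .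
qed (use assms in \<open>auto simp: convolution_semigroup_def sets_point_measure\<close>)

text \<open>
  The argument \<open>s\<close> ranges over all reals. Where the indicator vanishes, the value is \<open>0\<close> whatever
  the other factors are (including \<open>s / 0 = 0\<close>).
\<close>

definition p :: "(real \<Rightarrow> (int ^ 'n) measure) \<Rightarrow> int ^ 'n \<Rightarrow> real \<Rightarrow> real ^ 'n \<Rightarrow> real"
  where "p \<mu> k s c =
    s / (s + inner_lattice c k) * mass \<mu> (s + inner_lattice c k) k *
      indicat_real {0<..} (s + inner_lattice c k)"

end

theory Submission
  imports Defs
begin

text \<open>
  Put \<open>t = \<langle>c, k\<rangle>\<close>. All terms vanish for \<open>t < 0\<close>; for \<open>t > 0\<close> the claim says that a bridge from \<open>0\<close> to
  \<open>k\<close> over time \<open>l + t\<close> has mean \<open>l / (l + t) * t\<close> at time \<open>l\<close>, in the direction \<open>c\<close>. Without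
  continuity in \<open>l\<close> and with possibly infinite total mass, this rests on a structure theorem: up to a
  scalar, every nonzero convolution semigroup on the lattice with finite point masses is compound
  Poisson, \<open>\<mu>\<^sub>l = g(l) * exp (l * \<nu>)\<close>.

  For this, cut two consecutive bridges into many short increments. Swapping increments between the two
  halves preserves the weight but moves the midpoint, so a Littlewood--Offord bound shows that few of
  the pairs are unequal. Hence most increments over a short time are equal, which on a lattice forces
  them to be 0. Thus the weights of no jump and of exactly one jump converge under dyadic refinement;
  the jump measure obtained is superadditive in time and therefore linear.

  For a compound Poisson semigroup the mean is computed for each number of jumps separately, by
  exchangeability of the jumps.
\<close>

section \<open>Convolution of weight functions\<close>

text \<open>With infinite total mass there is neither a Fourier transform nor a probability law of
  the increments. The finite weight of all paths pinned at a fixed endpoint takes over the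
  normalisation: every estimate is relative to it, and tails are cut off only for pinned products.
  Equality of most pairs alone does not make the increments constant, since both halves could repeat
  one nontrivial path. Comparing a block with the cyclic rotation of its partner excludes this, and
  a constant nonzero increment repeated often enough leaves every finite set. The scalar g need not
  be an exponential: without continuity it can be the exponential of any additive function of time.
  This is why jumps are measured by odds against the increment 0, why limits are taken along a / 2^n
  only, and why linearity in time has to come from superadditivity.\<close>

abbreviation nsum :: "('a \<Rightarrow> ennreal) \<Rightarrow> ennreal"
  where "nsum f \<equiv> integral\<^sup>N (count_space UNIV) f"

lemma nsum_swap: "nsum (\<lambda>x. nsum (\<lambda>y. f x y)) = nsum (\<lambda>y. nsum (\<lambda>x. f x y))"
  using nn_integral_fst_count_space[of "\<lambda>(x, y). f x y"]
    nn_integral_snd_count_space[of "\<lambda>(x, y). f x y"] by simp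

lemma nsum_bij: "bij g \<Longrightarrow> nsum (\<lambda>x. f (g x)) = nsum f"
  by (rule nn_integral_bij_count_space)

lemma bij_shift: "bij (\<lambda>x. x - a)" "bij (\<lambda>x. a - x)" for a :: "'g::ab_group_add"
  by (auto intro: bij_betw_byWitness[where f' = "\<lambda>x. x + a"] bij_betw_byWitness[where f' = "\<lambda>x. a - x"])

lemma nsum_shift: "nsum (\<lambda>x. f (x - a)) = nsum f" for a :: "'g::ab_group_add"
  by (rule nsum_bij[OF bij_shift(1)])

lemma nsum_reflect: "nsum (\<lambda>x. f (a - x)) = nsum f" for a :: "'g::ab_group_add"
  by (rule nsum_bij[OF bij_shift(2)])

lemma nsum_single: "(\<And>x. x \<noteq> a \<Longrightarrow> f x = 0) \<Longrightarrow> nsum f = f a"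
  by (subst nn_integral_count_space'[of "{a}"]) auto

lemma nsum_ge_point: "f a \<le> nsum f"
  by (rule nn_integral_ge_point) simp

lemma nsum_ge_sum: "finite A \<Longrightarrow> sum f A \<le> nsum f"
  by (subst nn_integral_count_space_finite[symmetric])
    (auto simp: nn_integral_count_space_indicator indicator_def intro!: nn_integral_mono)

lemma nsum_add: "nsum (\<lambda>x. f x + g x) = nsum f + nsum g"
  by (rule nn_integral_add) auto

lemma nsum_cmult: "nsum (\<lambda>x. c * f x) = c * nsum f"
  by (rule nn_integral_cmult) auto

lemma nsum_multc: "nsum (\<lambda>x. f x * c) = nsum f * c"
  by (rule nn_integral_multc) auto

lemma nsum_sum: "nsum (\<lambda>x. \<Sum>i\<in>I. f i x) = (\<Sum>i\<in>I. nsum (f i))"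
  by (rule nn_integral_sum) auto

lemma nsum_mono: "(\<And>x. f x \<le> g x) \<Longrightarrow> nsum f \<le> nsum g"
  by (rule nn_integral_mono)

lemma nsum_prod: "nsum (\<lambda>z. f z) = nsum (\<lambda>x. nsum (\<lambda>y. f (x, y)))"
  by (rule nn_integral_fst_count_space[symmetric])

lemma nsum_prod': "nsum (\<lambda>z. f z) = nsum (\<lambda>y. nsum (\<lambda>x. f (x, y)))"
  by (rule nn_integral_snd_count_space[symmetric])

lemma nsum_tail_small:
  fixes f :: "'a::countable \<Rightarrow> ennreal"
  assumes "nsum f < \<infinity>" "0 < e"
  obtains Y where "finite Y" "nsum (\<lambda>x. f x * indicator (- Y) x) < e"
proof -
  let ?Y = "\<lambda>n. {x::'a. to_nat x < n}"
  have "(\<lambda>n. nsum (\<lambda>x. f x * indicator (- ?Y n) x)) \<longlonglongrightarrow> nsum (\<lambda>x::'a. 0)"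
  proof (rule nn_integral_dominated_convergence[where w = f and u' = "\<lambda>_. 0"])
    show "AE x in count_space UNIV. (\<lambda>n. f x * indicator (- ?Y n) x) \<longlonglongrightarrow> 0"
    proof (intro AE_I2 tendsto_eventually)
      fix x
      show "\<forall>\<^sub>F n in sequentially. f x * indicator (- ?Y n) x = 0"
        using eventually_gt_at_top[of "to_nat x"] by eventually_elim auto
    qed
  qed (use assms in \<open>auto simp: indicator_def\<close>)
  then have "\<forall>\<^sub>F n in sequentially. nsum (\<lambda>x. f x * indicator (- ?Y n) x) < e"
    using assms by (intro order_tendstoD) auto
  then obtain n where "nsum (\<lambda>x. f x * indicator (- ?Y n) x) < e"
    by (auto simp: eventually_sequentially)
  moreover have "finite (?Y n)"
    using finite_vimageI[OF finite_lessThan[of n] inj_to_nat] by (simp add: vimage_def)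
  ultimately show ?thesis using that by blast
qed

text \<open>A separate type lets convolution be the product of a commutative semiring, so that
  powers and the binomial theorem apply. With values in [0, \<infinity>] every rearrangement is
  Tonelli, at the price of subtraction.\<close>

typedef 'g weights = "UNIV :: ('g \<Rightarrow> ennreal) set"
  morphisms wt Weights by simp

setup_lifting type_definition_weights

lemma weights_eqI: "(\<And>x. wt f x = wt g x) \<Longrightarrow> f = g"
  by transfer auto

instantiation weights :: (ab_group_add) comm_semiring_1
begin

lift_definition zero_weights :: "'a weights" is "\<lambda>_. 0" .
lift_definition one_weights :: "'a weights" is "\<lambda>x. if x = 0 then 1 else 0" .
lift_definition plus_weights :: "'a weights \<Rightarrow> 'a weights \<Rightarrow> 'a weights" is "\<lambda>f g x. f x + g x" .
lift_definition times_weights :: "'a weights \<Rightarrow> 'a weights \<Rightarrow> 'a weights"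
  is "\<lambda>f g x. nsum (\<lambda>y. f y * g (x - y))" .

instance
proof
  fix f g h :: "'a weights"
  show "f + g + h = f + (g + h)" by transfer (simp add: ac_simps)
  show "f + g = g + f" by transfer (simp add: ac_simps)
  show "0 + f = f" by transfer simp
  show "0 * f = 0" by transfer simp
  show "f * 0 = 0" by transfer simp
  show "(0::'a weights) \<noteq> 1" by transfer (auto simp: fun_eq_iff)
  show comm: "f * g = g * f" for f g :: "'a weights"
  proof (transfer, rule ext)
    fix f g :: "'a \<Rightarrow> ennreal" and x
    show "nsum (\<lambda>y. f y * g (x - y)) = nsum (\<lambda>y. g y * f (x - y))"
      using nsum_reflect[of "\<lambda>y. g y * f (x - y)" x] by (simp add: mult.commute)
  qed
  show "1 * f = f"
  proof (transfer, rule ext)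
    fix f :: "'a \<Rightarrow> ennreal" and x
    show "nsum (\<lambda>y. (if y = 0 then 1 else 0) * f (x - y)) = f x"
      by (subst nsum_single[of 0]) auto
  qed
  show "(f + g) * h = f * h + g * h"
    by transfer (simp add: distrib_right nsum_add)
  show "f * g * h = f * (g * h)"
  proof (transfer, rule ext)
    fix f g h :: "'a \<Rightarrow> ennreal" and x
    have "nsum (\<lambda>y. nsum (\<lambda>z. f z * g (y - z)) * h (x - y))
        = nsum (\<lambda>z. nsum (\<lambda>y. f z * (g (y - z) * h (x - y))))"
      by (subst nsum_swap) (simp add: nsum_multc[symmetric] mult.assoc)
    also have "\<dots> = nsum (\<lambda>z. f z * nsum (\<lambda>y. g (y - z) * h (x - z - (y - z))))"
      by (simp add: nsum_cmult)
    also have "\<dots> = nsum (\<lambda>z. f z * nsum (\<lambda>y. g y * h (x - z - y)))"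
      by (subst nsum_shift) (rule refl)
    finally show "nsum (\<lambda>y. nsum (\<lambda>z. f z * g (y - z)) * h (x - y))
        = nsum (\<lambda>y. f y * nsum (\<lambda>z. g z * h (x - y - z)))" .
  qed
qed

end

lemma wt_add [simp]: "wt (f + g) x = wt f x + wt g x"
  by transfer simp

lemma wt_zero [simp]: "wt 0 x = 0"
  by transfer simp

lemma wt_one: "wt 1 x = (if x = 0 then 1 else 0)"
  by transfer simp

lemma wt_mult: "wt (f * g) x = nsum (\<lambda>y. wt f y * wt g (x - y))"
  by transfer simp

lemma wt_sum [simp]: "wt (\<Sum>i\<in>I. f i) x = (\<Sum>i\<in>I. wt (f i) x)"
  by (induction I rule: infinite_finite_induct) auto

lemma wt_of_nat_mult [simp]: "wt (of_nat n * f) x = of_nat n * wt f x"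
  by (induction n) (auto simp: algebra_simps)

lemma wt_Weights [simp]: "wt (Weights f) = f"
  by (simp add: Weights_inverse)

lemma wt_mult_ge: "wt f x * wt g y \<le> wt (f * g) (x + y)"
  using nsum_ge_point[of "\<lambda>z. wt f z * wt g (x + y - z)" x] by (simp add: wt_mult)

lemma wt_mult_mono: "(\<And>x. wt f x \<le> wt f' x) \<Longrightarrow> (\<And>x. wt g x \<le> wt g' x) \<Longrightarrow> wt (f * g) x \<le> wt (f' * g') x"
  by (auto simp: wt_mult intro!: nsum_mono mult_mono)

lemma wt_power_mono: "(\<And>x. wt f x \<le> wt g x) \<Longrightarrow> wt (f ^ n) x \<le> wt (g ^ n) x"
  by (induction n arbitrary: x) (auto intro!: wt_mult_mono)

lemma nsum_wt_mult: "nsum (\<lambda>z. wt (f * g) z * \<phi> z) = nsum (\<lambda>x. wt f x * nsum (\<lambda>y. wt g y * \<phi> (x + y)))"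
proof -
  have "nsum (\<lambda>z. wt (f * g) z * \<phi> z) = nsum (\<lambda>x. nsum (\<lambda>z. wt f x * (wt g (z - x) * \<phi> z)))"
    by (subst nsum_swap) (simp add: wt_mult nsum_multc[symmetric] mult.assoc)
  also have "\<dots> = nsum (\<lambda>x. wt f x * nsum (\<lambda>z. wt g (z - x) * \<phi> (x + (z - x))))"
    by (simp add: nsum_cmult)
  also have "\<dots> = nsum (\<lambda>x. wt f x * nsum (\<lambda>y. wt g y * \<phi> (x + y)))"
    by (subst nsum_shift) (rule refl)
  finally show ?thesis .
qed

text \<open>A scalar as a multiple of the unit mass at 0, so that scaling is itself a product in the
  semiring.\<close>

definition const_weights :: "ennreal \<Rightarrow> 'g::ab_group_add weights"
  where "const_weights c = Weights (\<lambda>x. if x = 0 then c else 0)"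

lemma wt_const_mult [simp]: "wt (const_weights c * f) x = c * wt f x"
  unfolding wt_mult const_weights_def by (subst nsum_single[of 0]) auto

lemma const_weights_power: "const_weights c ^ n = const_weights (c ^ n)"
proof (induction n)
  case (Suc n)
  show ?case unfolding power_Suc Suc by (rule weights_eqI) (simp, simp add: const_weights_def)
qed (auto intro!: weights_eqI simp: const_weights_def wt_one)

text \<open>In a point (x, z), x is the displacement in the first half and z that in both halves;
  \<open>total\<close> forgets x. It is multiplicative and additive, so products can be evaluated at
  the endpoint.\<close>

definition total :: "('g \<times> 'h) weights \<Rightarrow> 'h weights"
  where "total M = Weights (\<lambda>z. nsum (\<lambda>x. wt M (x, z)))"

lemma wt_total: "wt (total M) z = nsum (\<lambda>x. wt M (x, z))"
  by (simp add: total_def)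

lemma total_add: "total (M + M') = total M + total M'"
  by (rule weights_eqI) (simp add: wt_total nsum_add)

lemma total_one: "total (1 :: ('g::ab_group_add \<times> 'h::ab_group_add) weights) = 1"
  by (rule weights_eqI) (auto simp: wt_total wt_one zero_prod_def nsum_single[of 0])

lemma total_mult: "total (M * M') = total M * total M'"
  for M M' :: "('g::ab_group_add \<times> 'h::ab_group_add) weights"
proof (rule weights_eqI)
  fix k
  have "wt (total (M * M')) k = nsum (\<lambda>x. nsum (\<lambda>z. nsum (\<lambda>a. wt M (a, z) * wt M' (x - a, k - z))))"
    by (simp add: wt_total wt_mult nsum_prod')
  also have "\<dots> = nsum (\<lambda>z. nsum (\<lambda>x. nsum (\<lambda>a. wt M (a, z) * wt M' (x - a, k - z))))"
    by (rule nsum_swap)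
  also have "\<dots> = nsum (\<lambda>z. nsum (\<lambda>a. nsum (\<lambda>x. wt M (a, z) * wt M' (x - a, k - z))))"
    by (subst (2) nsum_swap) (rule refl)
  also have "\<dots> = nsum (\<lambda>z. nsum (\<lambda>a. wt M (a, z) * nsum (\<lambda>x. wt M' (x, k - z))))"
    by (subst nsum_cmult, subst nsum_shift[where f = "\<lambda>x. wt M' (x, _)"]) (rule refl)
  also have "\<dots> = wt (total M * total M') k"
    by (simp add: wt_total wt_mult nsum_multc)
  finally show "wt (total (M * M')) k = wt (total M * total M') k" .
qed

lemma total_power: "total (M ^ n) = total M ^ n"
  for M :: "('g::ab_group_add \<times> 'h::ab_group_add) weights"
  by (induction n) (auto simp: total_one total_mult)

lemma total_sum: "total (\<Sum>i\<in>I. M i) = (\<Sum>i\<in>I. total (M i))"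
  by (rule weights_eqI) (simp add: wt_total nsum_sum)

lemma total_of_nat_mult: "total (of_nat n * M) = of_nat n * total M"
  for M :: "('g::ab_group_add \<times> 'h::ab_group_add) weights"
  by (rule weights_eqI) (simp add: wt_total nsum_cmult)

section \<open>Anticoncentration\<close>

text \<open>The probability that a simple random walk started at r has not hit 0 within j steps. By
  reflection it is the sum of the r largest probabilities of j fair coin tosses (of all if r > j),
  the bound of Erdos in the Littlewood-Offord problem.\<close>

primrec survival :: "nat \<Rightarrow> nat \<Rightarrow> real"
  where
    "survival 0 r = (if r = 0 then 0 else 1)"
  | "survival (Suc j) r = (if r = 0 then 0 else (survival j (r + 1) + survival j (r - 1)) / 2)"

lemma survival_0 [simp]: "survival j 0 = 0"
  by (cases j) auto

text \<open>Concavity in r has two uses: averaging neighbours becomes a decrease in j, and the sum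
  of the values at r + d and r - d is bounded by its value for d = 1.\<close>

lemma survival_concave: "survival j (r + 2) + survival j r \<le> 2 * survival j (r + 1)"
proof (induction j arbitrary: r)
  case (Suc j)
  show ?case
    using Suc[of "r + 1"] Suc[of "r - 1"] Suc[of 0] by (cases r) (auto simp: field_simps numeral_2_eq_2)
qed auto

lemma survival_nonneg: "0 \<le> survival j r"
  by (induction j arbitrary: r) auto

lemma survival_le_1: "survival j r \<le> 1"
proof (induction j arbitrary: r)
  case (Suc j)
  show ?case using Suc[of "r + 1"] Suc[of "r - 1"] by simp
qed simp

lemma survival_Suc_le: "survival (Suc j) r \<le> survival j r"
  using survival_concave[of j "r - 1"] by (cases r) auto

lemma survival_antimono: "i \<le> j \<Longrightarrow> survival j r \<le> survival i r"
  using decseq_SucI[of "\<lambda>j. survival j r"] survival_Suc_le by (simp add: decseq_def)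

lemma survival_spread:
  assumes "d \<le> r" "1 \<le> d"
  shows "survival j (r + d) + survival j (r - d) \<le> survival j (r + 1) + survival j (r - 1)"
  using assms(2,1)
proof (induction d rule: dec_induct)
  case (step d)
  have incr: "survival j (a + n + 1) - survival j (a + n) \<le> survival j (a + 1) - survival j a" for a n
  proof (induction n)
    case (Suc n)
    then show ?case using survival_concave[of j "a + n"] by (simp add: numeral_2_eq_2)
  qed auto
  from incr[of "r - Suc d" "Suc (2 * d)"] step
  have "survival j (r + Suc d) + survival j (r - Suc d) \<le> survival j (r + d) + survival j (r - d)"
    by (simp add: algebra_simps mult_2 Suc_diff_Suc)
  with step show ?case by simp
qed auto

text \<open>The limit in \<open>j\<close> is a bounded discrete harmonic function vanishing at 0.\<close>

lemma survival_tendsto_0: "(\<lambda>j. survival j r) \<longlonglongrightarrow> 0"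
proof -
  define L where "L r = lim (\<lambda>j. survival j r)" for r
  have lim: "(\<lambda>j. survival j r) \<longlonglongrightarrow> L r" for r
  proof -
    have "convergent (\<lambda>j. survival j r)"
    proof (rule Bseq_monoseq_convergent)
      show "Bseq (\<lambda>j. survival j r)"
        by (rule BseqI'[where K = 1]) (simp add: survival_nonneg survival_le_1)
      show "monoseq (\<lambda>j. survival j r)"
        by (intro decseq_imp_monoseq decseq_SucI survival_Suc_le)
    qed
    then show ?thesis by (simp add: L_def convergent_LIMSEQ_iff)
  qed
  have L0: "L 0 = 0"
    using LIMSEQ_unique[OF lim[of 0]] by simp
  have harm: "2 * L (Suc r) = L (r + 2) + L r" for r
  proof -
    have "(\<lambda>j. survival (Suc j) (Suc r)) \<longlonglongrightarrow> L (Suc r)"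
      using lim LIMSEQ_Suc by blast
    moreover have "(\<lambda>j. survival (Suc j) (Suc r)) \<longlonglongrightarrow> (L (r + 2) + L r) / 2"
      using tendsto_add[OF lim[of "r + 2"] lim[of r]] by (auto intro!: tendsto_divide)
    ultimately show ?thesis using LIMSEQ_unique by fastforce
  qed
  have lin: "L n = real n * L 1 \<and> L (Suc n) = real (Suc n) * L 1" for n
  proof (induction n)
    case (Suc n)
    then show ?case using harm[of n] by (simp add: algebra_simps)
  qed (simp add: L0)
  have "L n \<le> 1" "0 \<le> L n" for n
    using lim survival_le_1 survival_nonneg LIMSEQ_le_const2 LIMSEQ_le_const by metis+
  then have "L 1 = 0"
    by (metis lin ex_less_of_nat_mult less_eq_real_def linorder_not_le)
  then show ?thesis using lim[of r] lin[of r] by simp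
qed

text \<open>Given the endpoint k, any n midpoints carry at most the fraction
  \<open>survival j n\<close> of the weight; j counts the independent fair swaps that blur the
  midpoint.\<close>

definition spread :: "nat \<Rightarrow> ('g \<times> 'g) weights \<Rightarrow> bool"
  where "spread j M \<longleftrightarrow> (\<forall>k Y. finite Y \<longrightarrow>
    (\<Sum>x\<in>Y. wt M (x, k)) \<le> ennreal (survival j (card Y)) * wt (total M) k)"

lemma spread_0: "spread 0 M"
  by (auto simp: spread_def wt_total card_eq_0_iff intro: nsum_ge_sum)

lemma spread_antimono: "i \<le> j \<Longrightarrow> spread j M \<Longrightarrow> spread i M"
  unfolding spread_def
  by (meson order_trans mult_right_mono ennreal_leI survival_antimono zero_le)

lemma spread_add: "spread j M \<Longrightarrow> spread j M' \<Longrightarrow> spread j (M + M')"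
  by (auto simp: spread_def total_add sum.distrib distrib_left intro!: add_mono)

lemma spread_zero: "spread j 0"
  by (simp add: spread_def)

lemma spread_sum: "(\<And>i. i \<in> I \<Longrightarrow> spread j (M i)) \<Longrightarrow> spread j (\<Sum>i\<in>I. M i)"
  by (induction I rule: infinite_finite_induct) (auto intro: spread_add spread_zero)

lemma spread_of_nat_mult: "spread j M \<Longrightarrow> spread j (of_nat n * M)"
  for M :: "('g::ab_group_add \<times> 'g) weights"
  by (induction n) (auto simp: algebra_simps intro: spread_add spread_zero)

lemma sum_wt_mult:
  fixes Q M :: "('g::ab_group_add \<times> 'g) weights"
  shows "(\<Sum>x\<in>Y. wt (Q * M) (x, k)) =
    nsum (\<lambda>z. nsum (\<lambda>a. wt Q (a, z) * (\<Sum>x\<in>(\<lambda>x. x - a) ` Y. wt M (x, k - z))))"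
  by (subst sum.reindex)
    (auto simp: inj_on_def wt_mult nsum_prod' nsum_sum[symmetric] sum_distrib_left)

lemma wt_total_mult:
  fixes Q M :: "('g::ab_group_add \<times> 'g) weights"
  shows "wt (total (Q * M)) k = nsum (\<lambda>z. nsum (\<lambda>a. wt Q (a, z) * wt (total M) (k - z)))"
  by (simp add: total_mult wt_mult wt_total nsum_multc)

text \<open>Fix the contribution (a, z) of \<open>Q\<close>: it merely replaces \<open>Y\<close> by
  its translate by -a, of the same size, and the endpoint k by k - z.\<close>

lemma spread_mult:
  fixes Q M :: "('g::ab_group_add \<times> 'g) weights"
  assumes "spread j M"
  shows "spread j (Q * M)"
  unfolding spread_def
proof (intro allI impI)
  fix k and Y :: "'g set" assume Y: "finite Y"
  have "(\<Sum>x\<in>Y. wt (Q * M) (x, k)) \<le>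
    nsum (\<lambda>z. nsum (\<lambda>a. wt Q (a, z) * (ennreal (survival j (card Y)) * wt (total M) (k - z))))"
    unfolding sum_wt_mult
  proof (intro nsum_mono mult_left_mono)
    fix z a
    show "(\<Sum>x\<in>(\<lambda>x. x - a) ` Y. wt M (x, k - z)) \<le> ennreal (survival j (card Y)) * wt (total M) (k - z)"
      using assms Y card_image[of "\<lambda>x. x - a" Y] unfolding spread_def
      by (metis finite_imageI bij_shift(1) bij_is_inj inj_on_subset subset_UNIV)
  qed auto
  also have "\<dots> = ennreal (survival j (card Y)) * wt (total (Q * M)) k"
    unfolding wt_total_mult by (simp add: nsum_cmult[symmetric] mult.left_commute)
  finally show "(\<Sum>x\<in>Y. wt (Q * M) (x, k)) \<le> ennreal (survival j (card Y)) * wt (total (Q * M)) k" .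
qed

text \<open>Translation by -a lowers the sum of the i-th coordinates over \<open>Y\<close> by
  \<open>card Y\<close> times the i-th coordinate of a, so different translations are told
  apart.\<close>

lemma translate_neq:
  fixes Y :: "(int ^ 'n) set"
  assumes "finite Y" "Y \<noteq> {}" "a \<noteq> b"
  shows "(\<lambda>x. x - a) ` Y \<noteq> (\<lambda>x. x - b) ` Y"
proof
  assume eq: "(\<lambda>x. x - a) ` Y = (\<lambda>x. x - b) ` Y"
  obtain i where i: "a $ i \<noteq> b $ i"
    using assms(3) by (auto simp: vec_eq_iff)
  have "(\<Sum>x\<in>Y. (x - a) $ i) = (\<Sum>x\<in>Y. (x - b) $ i)"
    using sum.reindex[of "\<lambda>x. x - a" Y "\<lambda>x. x $ i"] sum.reindex[of "\<lambda>x. x - b" Y "\<lambda>x. x $ i"] eq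
    by (simp add: inj_on_def)
  then have "int (card Y) * (a $ i) = int (card Y) * (b $ i)"
    by (simp add: sum_subtractf)
  then show False using i assms by simp
qed

text \<open>The Littlewood-Offord step. Two different translates of size r have a union of size r +
  d and an intersection of size r - d with d \<ge> 1. Their weights add up to those of union and
  intersection, and by concavity d = 1 is the worst case.\<close>

lemma survival_translates:
  fixes Y :: "(int ^ 'n) set"
  assumes M: "spread j M" and Y: "finite Y" and ab: "a \<noteq> b"
  shows "(\<Sum>x\<in>(\<lambda>x. x - a) ` Y. wt M (x, k)) + (\<Sum>x\<in>(\<lambda>x. x - b) ` Y. wt M (x, k))
    \<le> 2 * (ennreal (survival (Suc j) (card Y)) * wt (total M) k)"
proof (cases "Y = {}")
  case False
  let ?A = "(\<lambda>x. x - a) ` Y" and ?B = "(\<lambda>x. x - b) ` Y" and ?r = "card Y"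
  have card: "card ?A = ?r" "card ?B = ?r"
    by (auto intro!: card_image simp: inj_on_def)
  have fin: "finite ?A" "finite ?B" using Y by auto
  define d where "d = ?r - card (?A \<inter> ?B)"
  have "?A \<inter> ?B \<subset> ?A"
    using translate_neq[OF Y False ab] card fin by (metis Int_lower1 Int_lower2 card_subset_eq psubsetI)
  then have "card (?A \<inter> ?B) < ?r"
    using fin card psubset_card_mono by metis
  then have d: "1 \<le> d" "d \<le> ?r" "card (?A \<inter> ?B) = ?r - d" "card (?A \<union> ?B) = ?r + d"
    using card_Un_Int[OF fin] card by (auto simp: d_def)
  have "(\<Sum>x\<in>?A. wt M (x, k)) + (\<Sum>x\<in>?B. wt M (x, k))
      = (\<Sum>x\<in>?A \<union> ?B. wt M (x, k)) + (\<Sum>x\<in>?A \<inter> ?B. wt M (x, k))"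
    using sum.union_inter[OF fin] by metis
  also have "\<dots> \<le> ennreal (survival j (?r + d)) * wt (total M) k + ennreal (survival j (?r - d)) * wt (total M) k"
    using M fin d unfolding spread_def by (metis add_mono finite_Int finite_UnI)
  also have "\<dots> = ennreal (survival j (?r + d) + survival j (?r - d)) * wt (total M) k"
    by (simp add: distrib_right survival_nonneg)
  also have "\<dots> \<le> ennreal (2 * survival (Suc j) ?r) * wt (total M) k"
    using survival_spread[of d ?r j] d False Y by (intro mult_right_mono ennreal_leI) auto
  also have "\<dots> = 2 * (ennreal (survival (Suc j) ?r) * wt (total M) k)"
    by (simp add: ennreal_mult' mult.assoc del: survival.simps)
  finally show ?thesis .
qed auto

text \<open>\<open>sym\<close> makes the exchange of a and z - a a fair coin, and
  \<open>diag\<close> makes its two outcomes different. Averaging over the coin turns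
  \<open>Y\<close> into two different translates, which is one more step of the walk behind
  \<open>survival\<close>.\<close>

lemma spread_mult_Suc:
  fixes N M :: "((int ^ 'n) \<times> (int ^ 'n)) weights"
  assumes M: "spread j M"
    and sym: "\<And>a z. wt N (z - a, z) = wt N (a, z)"
    and diag: "\<And>a. wt N (a, a + a) = 0"
  shows "spread (Suc j) (N * M)"
  unfolding spread_def
proof (intro allI impI)
  fix k and Y :: "(int ^ 'n) set" assume Y: "finite Y"
  let ?G = "\<lambda>a z. \<Sum>x\<in>(\<lambda>x. x - a) ` Y. wt M (x, k - z)"
  let ?s = "\<Sum>x\<in>Y. wt (N * M) (x, k)" and ?b = "ennreal (survival (Suc j) (card Y))"
  have 1: "?s = nsum (\<lambda>z. nsum (\<lambda>a. wt N (a, z) * ?G a z))"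
    by (rule sum_wt_mult)
  also have "\<dots> = nsum (\<lambda>z. nsum (\<lambda>a. wt N (z - a, z) * ?G (z - a) z))"
    by (intro nn_integral_cong nsum_reflect[of "\<lambda>a. wt N (a, _) * ?G a _", symmetric])
  finally have 2: "?s = nsum (\<lambda>z. nsum (\<lambda>a. wt N (a, z) * ?G (z - a) z))"
    by (simp add: sym)
  have "2 * ?s = nsum (\<lambda>z. nsum (\<lambda>a. wt N (a, z) * (?G a z + ?G (z - a) z)))"
    unfolding mult_2 distrib_left nsum_add using 1 2 by metis
  also have "\<dots> \<le> nsum (\<lambda>z. nsum (\<lambda>a. wt N (a, z) * (2 * (?b * wt (total M) (k - z)))))"
  proof (intro nsum_mono)
    fix z a
    show "wt N (a, z) * (?G a z + ?G (z - a) z) \<le> wt N (a, z) * (2 * (?b * wt (total M) (k - z)))"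
    proof (cases "z - a = a")
      case True
      then have "z = a + a" by (simp add: algebra_simps)
      then show ?thesis using diag by simp
    next
      case False
      then show ?thesis
        by (intro mult_left_mono survival_translates[OF M Y]) auto
    qed
  qed
  also have "\<dots> = 2 * (?b * wt (total (N * M)) k)"
    unfolding wt_total_mult by (simp add: nsum_cmult[symmetric] mult.left_commute del: survival.simps)
  finally show "?s \<le> ?b * wt (total (N * M)) k"
    by (subst (asm) ennreal_mult_le_mult_iff) auto
qed

section \<open>Equal and unequal pairs of increments\<close>

text \<open>The coordinates are the first increment and the sum of both, rather than the two
  increments, so that \<open>total\<close> reads off the sum.\<close>

definition pair :: "'g::ab_group_add weights \<Rightarrow> ('g \<times> 'g) weights"
  where "pair f = Weights (\<lambda>(a, z). wt f a * wt f (z - a))"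

definition pair_equal :: "'g::ab_group_add weights \<Rightarrow> ('g \<times> 'g) weights"
  where "pair_equal f = Weights (\<lambda>(a, z). if z = a + a then wt f a * wt f a else 0)"

definition pair_unequal :: "'g::ab_group_add weights \<Rightarrow> ('g \<times> 'g) weights"
  where "pair_unequal f = Weights (\<lambda>(a, z). if z = a + a then 0 else wt f a * wt f (z - a))"

text \<open>The weight of m pairs not all of which are equal, split at the first unequal pair. The
  recursion stands in for a difference, since infinite weights cannot be subtracted.\<close>

primrec some_unequal :: "'g::ab_group_add weights \<Rightarrow> nat \<Rightarrow> ('g \<times> 'g) weights"
  where
    "some_unequal f 0 = 0"
  | "some_unequal f (Suc m) = pair_equal f * some_unequal f m + pair_unequal f * pair f ^ m"

lemma pair_split: "pair f = pair_equal f + pair_unequal f"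
  by (rule weights_eqI) (auto simp: pair_def pair_equal_def pair_unequal_def)

lemma pair_power_split: "pair f ^ m = pair_equal f ^ m + some_unequal f m"
proof (induction m)
  case (Suc m)
  have "pair f ^ Suc m = pair_equal f * pair f ^ m + pair_unequal f * pair f ^ m"
    by (simp add: pair_split algebra_simps)
  also have "pair_equal f * pair f ^ m = pair_equal f ^ Suc m + pair_equal f * some_unequal f m"
    by (subst Suc) (simp add: algebra_simps)
  finally show ?case by (simp add: ac_simps)
qed simp

lemma total_pair: "total (pair f) = f * f"
  by (rule weights_eqI) (simp add: wt_total wt_mult pair_def)

lemma pair_mult: "pair f * pair g = pair (f * g)"
proof (rule weights_eqI, clarify)
  fix x z
  have "wt (pair f * pair g) (x, z)
      = nsum (\<lambda>a. nsum (\<lambda>w. wt f a * wt g (x - a) * (wt f (w - a) * wt g (z - x - (w - a)))))"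
    by (simp add: wt_mult nsum_prod pair_def algebra_simps)
  also have "\<dots> = nsum (\<lambda>a. wt f a * wt g (x - a) * nsum (\<lambda>w. wt f w * wt g (z - x - w)))"
    by (subst nsum_cmult, subst nsum_shift[where f = "\<lambda>w. wt f w * wt g (_ - w)"]) (rule refl)
  also have "\<dots> = wt (pair (f * g)) (x, z)"
    by (simp add: pair_def wt_mult nsum_multc)
  finally show "wt (pair f * pair g) (x, z) = wt (pair (f * g)) (x, z)" .
qed

lemma pair_power: "pair f ^ n = pair (f ^ n)"
proof (induction n)
  case 0
  show ?case by (rule weights_eqI) (auto simp: pair_def wt_one zero_prod_def split: if_splits)
qed (simp add: pair_mult)

text \<open>One unequal pair gives one more fair swap; the pairs before and after it only translate
  the picture.\<close>

lemma spread_some_unequal: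
  fixes f :: "(int ^ 'n) weights"
  assumes "spread j M"
  shows "spread (Suc j) (some_unequal f m * M)"
proof (induction m)
  case (Suc m)
  have "some_unequal f (Suc m) * M
      = pair_equal f * (some_unequal f m * M) + pair_unequal f * (pair f ^ m * M)"
    by (simp add: algebra_simps)
  moreover have "spread (Suc j) (pair_unequal f * (pair f ^ m * M))"
    by (intro spread_mult_Suc spread_mult assms) (auto simp: pair_unequal_def algebra_simps)
  ultimately show ?case by (simp add: spread_add spread_mult Suc)
qed (simp add: spread_zero)

text \<open>
  Exchangeability: among \<open>K\<close> factors \<open>A + B\<close>, the expected number of factors \<open>B\<close> is \<open>K\<close> times
  the weight of a fixed factor being \<open>B\<close>; having more than \<open>R\<close> of them spreads the mass out of the
  finite set \<open>Y\<close>.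
\<close>

lemma fixed_factor_bound:
  fixes A B :: "((int ^ 'n) \<times> (int ^ 'n)) weights"
  assumes B: "\<And>j M. spread j M \<Longrightarrow> spread (Suc j) (B * M)" and Y: "finite Y" and K: "K \<ge> 1"
  shows "of_nat K * wt (total (B * (A + B) ^ (K - 1))) k
    \<le> of_nat R * wt (total ((A + B) ^ K)) k
      + of_nat K * (ennreal (survival R (card Y)) * wt (total ((A + B) ^ K)) k
        + nsum (\<lambda>x. wt ((A + B) ^ K) (x, k) * indicator (- Y) x))"
proof -
  \<comment> \<open>\<open>C j\<close> is the weight of exactly j of the K factors being
    \<open>B\<close>.\<close>
  define C where "C j = of_nat (K choose j) * B ^ j * A ^ (K - j)" for j
  define t where "t j = wt (total (C j)) k" for j
  define M where "M = (\<Sum>j\<in>{j. j \<le> K \<and> R < j}. C j)"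
  obtain n where n: "K = Suc n" using K by (cases K) auto
  have sumC: "(A + B) ^ K = (\<Sum>j\<le>K. C j)"
    unfolding C_def by (subst add.commute) (rule binomial_ring)
  \<comment> \<open>Double counting of configurations with one marked factor \<open>B\<close>:
    choose the mark first, or choose all j factors \<open>B\<close> first and then one of
    them.\<close>
  have "of_nat K * (B * (A + B) ^ (K - 1)) = of_nat (Suc n) * (B * (B + A) ^ n)"
    by (simp add: n add.commute)
  also have "\<dots> = (\<Sum>i\<le>n. of_nat (Suc n) * (B * (of_nat (n choose i) * B ^ i * A ^ (n - i))))"
    by (simp only: binomial_ring sum_distrib_left)
  also have "\<dots> = (\<Sum>i\<le>n. of_nat (Suc i) * C (Suc i))"
  proof (rule sum.cong)
    fix i
    have "of_nat (Suc n) * (B * (of_nat (n choose i) * B ^ i * A ^ (n - i)))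
        = of_nat (Suc n * (n choose i)) * (B ^ Suc i * A ^ (n - i))"
      by (simp only: of_nat_mult power_Suc ac_simps)
    also have "\<dots> = of_nat (Suc i * (Suc n choose Suc i)) * (B ^ Suc i * A ^ (n - i))"
      by (simp only: Suc_times_binomial)
    also have "\<dots> = of_nat (Suc i) * C (Suc i)"
      by (simp only: C_def n of_nat_mult diff_Suc_Suc ac_simps)
    finally show "of_nat (Suc n) * (B * (of_nat (n choose i) * B ^ i * A ^ (n - i)))
        = of_nat (Suc i) * C (Suc i)" .
  qed simp
  also have "\<dots> = (\<Sum>j\<le>K. of_nat j * C j)"
    unfolding n by (subst sum.atMost_Suc_shift) simp
  finally have marked: "of_nat K * (B * (A + B) ^ (K - 1)) = (\<Sum>j\<le>K. of_nat j * C j)" .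
  have "of_nat K * wt (total (B * (A + B) ^ (K - 1))) k = wt (total (\<Sum>j\<le>K. of_nat j * C j)) k"
    unfolding marked[symmetric] by (simp add: total_of_nat_mult)
  also have "\<dots> = (\<Sum>j\<le>K. of_nat j * t j)"
    by (simp add: total_sum total_of_nat_mult t_def)
  \<comment> \<open>The factor j is bounded by R where it can be, and by K otherwise.\<close>
  also have "\<dots> \<le> (\<Sum>j\<le>K. of_nat R * t j + of_nat K * (if R < j then t j else 0))"
  proof (rule sum_mono)
    fix j assume "j \<in> {..K}"
    then show "of_nat j * t j \<le> of_nat R * t j + of_nat K * (if R < j then t j else 0)"
      by (auto intro!: mult_right_mono intro: order.trans[OF _ add_increasing[OF _ order_refl]])
  qed
  also have "\<dots> = of_nat R * (\<Sum>j\<le>K. t j) + of_nat K * (\<Sum>j\<le>K. if R < j then t j else 0)"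
    by (simp add: sum.distrib sum_distrib_left)
  also have "(\<Sum>j\<le>K. t j) = wt (total ((A + B) ^ K)) k"
    by (simp add: sumC total_sum t_def)
  also have "(\<Sum>j\<le>K. if R < j then t j else 0) = wt (total M) k"
    by (auto simp: M_def total_sum t_def split: if_splits intro!: sum.mono_neutral_cong_right)
  \<comment> \<open>Each term of \<open>M\<close> has more than R factors \<open>B\<close>, so
    \<open>M\<close> is spread at level R: its midpoints in \<open>Y\<close> are controlled by
    \<open>survival\<close>, the others lie in the tail.\<close>
  also have "wt (total M) k \<le> ennreal (survival R (card Y)) * wt (total ((A + B) ^ K)) k
        + nsum (\<lambda>x. wt ((A + B) ^ K) (x, k) * indicator (- Y) x)"
  proof -
    have M_le: "wt M x \<le> wt ((A + B) ^ K) x" for x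
      unfolding sumC M_def wt_sum by (intro sum_mono2) auto
    have spreadC: "spread j (C j)" for j
    proof -
      have "spread i (B ^ i * A ^ (K - j))" for i
        by (induction i) (auto simp: spread_0 mult.assoc intro: B)
      then show ?thesis unfolding C_def mult.assoc by (rule spread_of_nat_mult)
    qed
    have "spread R M"
      unfolding M_def by (intro spread_sum spread_antimono[OF _ spreadC]) auto
    have "wt (total M) k = nsum (\<lambda>x. wt M (x, k) * indicator Y x + wt M (x, k) * indicator (- Y) x)"
      unfolding wt_total by (rule nn_integral_cong) (auto simp: indicator_def)
    also have "\<dots> = nsum (\<lambda>x. wt M (x, k) * indicator Y x) + nsum (\<lambda>x. wt M (x, k) * indicator (- Y) x)"
      by (rule nsum_add)
    also have "nsum (\<lambda>x. wt M (x, k) * indicator Y x) = (\<Sum>x\<in>Y. wt M (x, k))"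
      using Y by (subst nn_integral_count_space'[of Y]) (auto simp: indicator_def)
    also have "\<dots> \<le> ennreal (survival R (card Y)) * wt (total M) k"
      using \<open>spread R M\<close> Y by (auto simp: spread_def)
    also have "\<dots> \<le> ennreal (survival R (card Y)) * wt (total ((A + B) ^ K)) k"
      using M_le by (intro mult_left_mono) (auto simp: wt_total intro: nsum_mono)
    finally show ?thesis
      using M_le by (auto simp: add_mono nsum_mono mult_right_mono order.trans[OF _ add_mono])
  qed
  finally show ?thesis by (simp add: add_left_mono mult_left_mono)
qed

section \<open>Words of increments and their cyclic rotation\<close>

definition push :: "('a \<Rightarrow> ennreal) \<Rightarrow> ('a \<Rightarrow> 'g) \<Rightarrow> 'g weights"
  where "push q g = Weights (\<lambda>z. nsum (\<lambda>a. q a * (if g a = z then 1 else 0)))"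

lemma push_id: "push (wt f) (\<lambda>x. x) = f"
  by (rule weights_eqI) (auto simp: push_def intro: nsum_single[THEN trans])

lemma total_pair_equal: "total (pair_equal f) = push (\<lambda>a. wt f a * wt f a) (\<lambda>a. a + a)"
  by (rule weights_eqI) (auto simp: wt_total push_def pair_equal_def intro!: nn_integral_cong)

lemma nsum_push: "nsum (\<lambda>z. wt (push q g) z * \<phi> z) = nsum (\<lambda>a. q a * \<phi> (g a))"
proof -
  have "nsum (\<lambda>z. wt (push q g) z * \<phi> z) = nsum (\<lambda>a. nsum (\<lambda>z. q a * (if g a = z then 1 else 0) * \<phi> z))"
    by (subst nsum_swap) (simp add: push_def nsum_multc)
  also have "\<dots> = nsum (\<lambda>a. q a * \<phi> (g a))"
    by (intro nn_integral_cong, subst nsum_single) auto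
  finally show ?thesis .
qed

text \<open>A convolution power forgets the single increments, which rotation has to permute; sums
  over words keep them.\<close>

abbreviation nsum_lists :: "nat \<Rightarrow> ('a list \<Rightarrow> ennreal) \<Rightarrow> ennreal"
  where "nsum_lists m \<equiv> integral\<^sup>N (count_space {xs. length xs = m})"

lemma nsum_lists_Suc: "nsum_lists (Suc m) \<phi> = nsum (\<lambda>a. nsum_lists m (\<lambda>xs. \<phi> (a # xs)))"
proof -
  have bij: "bij_betw (\<lambda>(a, xs). a # xs) (UNIV \<times> {xs. length xs = m}) {xs. length xs = Suc m}"
    by (rule bij_betw_byWitness[where f' = "\<lambda>xs. (hd xs, tl xs)"]) (auto simp: length_Suc_conv)
  have "nsum_lists (Suc m) \<phi> = (\<integral>\<^sup>+z. \<phi> (fst z # snd z) \<partial>count_space (UNIV \<times> {xs. length xs = m}))"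
    using nn_integral_bij_count_space[OF bij, of \<phi>] by (simp add: case_prod_beta)
  also have "\<dots> = nsum (\<lambda>a. nsum (\<lambda>xs. \<phi> (a # xs) * indicator {xs. length xs = m} xs))"
    by (subst nn_integral_count_space_indicator)
      (auto simp: nsum_prod indicator_def intro!: nn_integral_cong)
  finally show ?thesis by (simp add: nn_integral_count_space_indicator)
qed

lemma nsum_lists_push:
  "nsum_lists m (\<lambda>xs. prod_list (map q xs) * \<phi> (sum_list (map g xs))) = nsum (\<lambda>z. wt (push q g ^ m) z * \<phi> z)"
proof (induction m arbitrary: \<phi>)
  case 0
  have "nsum (\<lambda>z. wt 1 z * \<phi> z) = \<phi> 0"
    by (subst nsum_single[of 0]) (auto simp: wt_one)
  then show ?case by (simp add: nn_integral_count_space_finite)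
next
  case (Suc m)
  have "nsum_lists (Suc m) (\<lambda>xs. prod_list (map q xs) * \<phi> (sum_list (map g xs)))
      = nsum (\<lambda>a. q a * nsum_lists m (\<lambda>xs. prod_list (map q xs) * \<phi> (g a + sum_list (map g xs))))"
    by (simp add: nsum_lists_Suc mult.assoc nn_integral_cmult)
  also have "\<dots> = nsum (\<lambda>a. q a * nsum (\<lambda>z. wt (push q g ^ m) z * \<phi> (g a + z)))"
    by (simp only: Suc[of "\<lambda>z. \<phi> (g _ + z)"])
  finally show ?case by (simp add: nsum_wt_mult nsum_push)
qed

lemma rotate1_fixed:
  assumes "rotate1 xs = xs"
  shows "xs = replicate (length xs) (hd xs)"
proof (rule nth_equalityI)
  fix i assume "i < length xs"
  then have "xs ! i = xs ! 0"
  proof (induction i)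
    case (Suc i)
    then have "rotate1 xs ! i = xs ! Suc i" by (subst nth_rotate1) auto
    with Suc assms show ?case by simp
  qed simp
  with \<open>i < length xs\<close> show "xs ! i = replicate (length xs) (hd xs) ! i"
    by (cases "xs = []") (simp_all add: hd_conv_nth)
qed simp

lemma prod_list_map_rotate1: "prod_list (map q (rotate1 xs)) = prod_list (map q xs)"
  for q :: "'a \<Rightarrow> 'b::comm_monoid_mult"
  by (cases xs) (auto simp: mult.commute)

lemma sum_list_rotate1: "sum_list (rotate1 xs) = sum_list xs"
  for xs :: "'a::ab_group_add list"
  by (cases xs) (auto simp: add.commute)

text \<open>
  Blocks \<open>as\<close>, \<open>bs\<close> with \<open>as = bs\<close> and \<open>as = rotate1 bs\<close> are constant, and both events have the
  same weight.
\<close>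

lemma equal_pairs_le:
  fixes f :: "'g::ab_group_add weights"
  assumes m: "m \<ge> 1"
  shows "2 * nsum (\<lambda>z. wt (total (pair_equal f) ^ m) z * H z)
    \<le> nsum (\<lambda>z. wt (f ^ m * f ^ m) z * H z)
      + nsum (\<lambda>w. wt f w ^ (2 * m) * H (sum_list (replicate (2 * m) w)))"
proof -
  define W where "W xs = prod_list (map (wt f) xs)" for xs
  define h where "h xs ys = W xs * W ys * H (sum_list xs + sum_list ys)" for xs ys
  have sum_double: "sum_list (map (\<lambda>a. a + a) xs) = sum_list xs + sum_list xs" for xs :: "'g list"
    by (induction xs) (auto simp: algebra_simps)
  have prod_double: "prod_list (map (\<lambda>a. wt f a * wt f a) xs) = W xs * W xs" for xs
    unfolding W_def by (induction xs) (auto simp: algebra_simps)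
  have "nsum (\<lambda>z. wt (total (pair_equal f) ^ m) z * H z) = nsum_lists m (\<lambda>xs. h xs xs)"
    by (simp add: total_pair_equal nsum_lists_push[symmetric] sum_double prod_double h_def)
  also have "2 * \<dots> = nsum_lists m (\<lambda>ys. h ys ys + h ys ys)"
    by (simp add: nn_integral_add mult_2)
  \<comment> \<open>For fixed \<open>ys\<close>, the partners \<open>ys\<close> and
    \<open>rotate1 ys\<close> give two terms of the inner sum with the same weight. If they
    coincide, the extra summand pays for the second copy.\<close>
  also have "\<dots> \<le> nsum_lists m (\<lambda>ys. nsum_lists m (\<lambda>xs. h xs ys) + (if rotate1 ys = ys then h ys ys else 0))"
  proof (rule nn_integral_mono)
    fix ys :: "'g list" assume "ys \<in> space (count_space {ys. length ys = m})"
    then have len: "length ys = m" by simp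
    have rot: "h (rotate1 ys) ys = h ys ys"
      by (simp add: h_def W_def prod_list_map_rotate1 sum_list_rotate1)
    show "h ys ys + h ys ys \<le> nsum_lists m (\<lambda>xs. h xs ys) + (if rotate1 ys = ys then h ys ys else 0)"
    proof (cases "rotate1 ys = ys")
      case True
      then show ?thesis
        using len nn_integral_ge_point[of ys "{xs. length xs = m}" "\<lambda>xs. h xs ys"] by (simp add: add_right_mono)
    next
      case False
      have "h ys ys + h ys ys = (\<Sum>xs\<in>{ys, rotate1 ys}. h xs ys * indicator {xs. length xs = m} xs)"
      proof -
        have "ys \<notin> {rotate1 ys}" using False by auto
        then show ?thesis using len rot by (subst sum.insert) (simp_all del: sum_mult_indicator)
      qed
      also have "\<dots> \<le> nsum (\<lambda>xs. h xs ys * indicator {xs. length xs = m} xs)"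
        by (rule nsum_ge_sum) simp
      finally show ?thesis using False by (simp add: nn_integral_count_space_indicator)
    qed
  qed
  also have "\<dots> = nsum_lists m (\<lambda>ys. nsum_lists m (\<lambda>xs. h xs ys))
      + nsum_lists m (\<lambda>ys. if rotate1 ys = ys then h ys ys else 0)"
    by (rule nn_integral_add) auto
  also have "nsum_lists m (\<lambda>ys. nsum_lists m (\<lambda>xs. h xs ys)) = nsum (\<lambda>z. wt (f ^ m * f ^ m) z * H z)"
  proof -
    have push: "nsum_lists m (\<lambda>xs. W xs * \<phi> (sum_list xs)) = nsum (\<lambda>z. wt (f ^ m) z * \<phi> z)" for \<phi>
      using nsum_lists_push[of m "wt f" \<phi> "\<lambda>x. x"] by (simp add: push_id W_def)
    have "nsum_lists m (\<lambda>xs. h xs ys) = W ys * nsum (\<lambda>z. wt (f ^ m) z * H (sum_list ys + z))" for ys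
      using push[of "\<lambda>z. H (sum_list ys + z)"]
      by (simp add: h_def mult.assoc mult.left_commute[of _ "W ys"] nn_integral_cmult add.commute)
    then show ?thesis
      using push[of "\<lambda>x. nsum (\<lambda>z. wt (f ^ m) z * H (x + z))"] by (simp add: nsum_wt_mult)
  qed
  also have "nsum_lists m (\<lambda>ys. if rotate1 ys = ys then h ys ys else 0)
      = nsum (\<lambda>w. wt f w ^ (2 * m) * H (sum_list (replicate (2 * m) w)))"
  proof -
    have bij: "bij_betw (replicate m) UNIV {ys :: 'g list. length ys = m \<and> rotate1 ys = ys}"
    proof (rule bij_betw_byWitness[where f' = hd])
      show "range (replicate m) \<subseteq> {ys :: 'g list. length ys = m \<and> rotate1 ys = ys}"
        by (auto intro: nth_equalityI simp: nth_rotate1)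
      show "\<forall>ys\<in>{ys :: 'g list. length ys = m \<and> rotate1 ys = ys}. replicate m (hd ys) = ys"
        using rotate1_fixed by (metis (mono_tags, lifting) mem_Collect_eq)
    qed (use m in auto)
    have eq: "wt f w ^ (2 * m) * H (sum_list (replicate (2 * m) w)) = h (replicate m w) (replicate m w)" for w
      by (simp add: h_def W_def mult_2 replicate_add power_add prod_list_replicate)
    have "nsum_lists m (\<lambda>ys. if rotate1 ys = ys then h ys ys else 0)
        = (\<integral>\<^sup>+ys. h ys ys \<partial>count_space {ys. length ys = m \<and> rotate1 ys = ys})"
      by (auto simp: nn_integral_count_space_indicator indicator_def intro!: nn_integral_cong)
    then show ?thesis
      using nn_integral_bij_count_space[OF bij, of "\<lambda>ys. h ys ys"] by (simp add: eq)
  qed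
  finally show ?thesis .
qed

section \<open>Vanishing increments\<close>

lemma nsum_inj_le:
  assumes "inj g" "\<And>x. h x \<le> G (g x)"
  shows "nsum h \<le> nsum G"
proof -
  have "nsum h \<le> nsum (\<lambda>x. G (g x))"
    by (rule nsum_mono) (rule assms)
  also have "\<dots> = (\<integral>\<^sup>+y. G y \<partial>count_space (range g))"
    by (rule nn_integral_bij_count_space) (use assms in \<open>simp add: bij_betw_def\<close>)
  also have "\<dots> \<le> nsum G"
    by (auto simp: nn_integral_count_space_indicator indicator_def intro!: nn_integral_mono)
  finally show ?thesis .
qed

lemma wt_power_ge: "wt f w ^ n \<le> wt (f ^ n) (sum_list (replicate n w))"
proof (induction n)
  case (Suc n)
  have "wt f w ^ Suc n \<le> wt f w * wt (f ^ n) (sum_list (replicate n w))"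
    using Suc by (simp add: mult_left_mono)
  also have "\<dots> \<le> wt (f ^ Suc n) (w + sum_list (replicate n w))"
    by (simp add: wt_mult_ge)
  finally show ?case by simp
qed (simp add: wt_one)

lemma sum_list_replicate_nth: "sum_list (replicate n w) $ i = int n * w $ i" for w :: "int ^ 'n"
  by (induction n) (auto simp: algebra_simps)

text \<open>A nonzero lattice vector has a coordinate of absolute value at least 1, so its n-fold
  multiple has one of at least n and leaves a bounded set. This is what forces constant words to be
  0.\<close>

lemma no_multiples:
  fixes Y :: "(int ^ 'n) set"
  assumes "finite Y"
  obtains b where "\<And>n w. n > b \<Longrightarrow> w \<noteq> 0 \<Longrightarrow> sum_list (replicate n w) \<notin> Y"
proof -
  have "finite ((\<lambda>(y, i). nat \<bar>y $ i\<bar>) ` (Y \<times> (UNIV :: 'n set)))"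
    using assms by auto
  then obtain b where b: "\<forall>v\<in>(\<lambda>(y, i). nat \<bar>y $ i\<bar>) ` (Y \<times> (UNIV :: 'n set)). v \<le> b"
    using finite_nat_set_iff_bounded_le by metis
  have "sum_list (replicate n w) \<notin> Y" if n: "n > b" and w: "w \<noteq> 0" for n and w :: "int ^ 'n"
  proof
    assume "sum_list (replicate n w) \<in> Y"
    then have "nat \<bar>sum_list (replicate n w) $ i\<bar> \<le> b" for i
      using b[rule_format, OF imageI, of "(sum_list (replicate n w), i)"] by simp
    then have le: "nat \<bar>int n * w $ i\<bar> \<le> b" for i
      by (simp add: sum_list_replicate_nth)
    obtain i where i: "w $ i \<noteq> 0" using w by (auto simp: vec_eq_iff)
    have "int n * \<bar>w $ i\<bar> \<le> int b"
      using le[of i] by (simp add: abs_mult nat_le_iff)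
    moreover have "int n * 1 \<le> int n * \<bar>w $ i\<bar>"
      using i by (intro mult_left_mono) auto
    ultimately show False using n by linarith
  qed
  then show ?thesis using that by blast
qed

text \<open>In turn, g is at least 7/8 D, c at least 3/4 D and z at least 5/8 D; finiteness makes
  the subtractions legitimate. In the application D is the weight of all bridges, g and u belong to
  equal and unequal pairs in one block, c to constant words, z to the word of zeros and r to the
  tail.\<close>

lemma ennreal_balance:
  fixes D g u c z r :: ennreal
  assumes "2 * g \<le> D + c" "D = g + u" "u \<le> ennreal (1 / 8) * D" "c \<le> z + r" "r \<le> ennreal (1 / 8) * D"
    and "D < \<top>" "z < \<top>"
  shows "D \<le> 2 * z"
proof -
  have "g \<le> D" "u \<le> D" using assms(2) by auto
  moreover have "ennreal (1 / 8) * D < \<top>" using assms(6) by (simp add: ennreal_mult_less_top)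
  ultimately have fin: "g < \<top>" "u < \<top>" "r < \<top>"
    using assms(5,6) by (auto intro: le_less_trans)
  then have "c < \<top>"
    using assms(4,7) le_less_trans[of c "z + r" \<top>] by simp
  note fin = fin this
  obtain D' g' u' c' z' r' where "D = ennreal D'" "g = ennreal g'" "u = ennreal u'" "c = ennreal c'"
    "z = ennreal z'" "r = ennreal r'" "0 \<le> D'" "0 \<le> g'" "0 \<le> u'" "0 \<le> c'" "0 \<le> z'" "0 \<le> r'"
    using fin assms(6,7) by (auto simp: less_top_ennreal)
  moreover have "2 * ennreal x = ennreal (2 * x)" if "0 \<le> x" for x
    using that by (simp add: ennreal_mult')
  ultimately show ?thesis
    using assms(1-5) by (simp add: ennreal_mult[symmetric] ennreal_plus[symmetric] del: ennreal_plus)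
qed

locale lattice_semigroup =
  fixes F :: "real \<Rightarrow> (int ^ 'n) weights"
  assumes F_add: "0 < a \<Longrightarrow> 0 < b \<Longrightarrow> F a * F b = F (a + b)"
    and F_finite: "0 < a \<Longrightarrow> wt (F a) x < \<top>"
begin

lemma F_power: "0 < a \<Longrightarrow> n \<ge> 1 \<Longrightarrow> F a ^ n = F (real n * a)"
proof (induction n)
  case (Suc n)
  show ?case
  proof (cases "n = 0")
    case False
    with Suc show ?thesis using F_add[of a "real n * a"] by (simp add: distrib_right)
  qed simp
qed simp

text \<open>Each half of duration l is cut into 2^q blocks of m steps of length s. The point is that
  q does not depend on m, so the mesh can be refined while the block length l / 2^q stays
  fixed.\<close>

lemma some_unequal_small:
  assumes l: "0 < l" and D: "0 < wt (F (2 * l)) k" and e: "0 < e"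
  obtains q where "q \<ge> 1" "\<And>m s. m \<ge> 1 \<Longrightarrow> s = l / (2 ^ q * real m) \<Longrightarrow>
    wt (total (some_unequal (F s) m * pair (F s) ^ (m * (2 ^ q - 1)))) k \<le> ennreal e * wt (F (2 * l)) k"
proof -
  define D where "D = wt (F (2 * l)) k"
  have D0: "0 < D" "D < \<top>" using assms F_finite[of "2 * l"] by (auto simp: D_def)
  have FF: "F l * F l = F (2 * l)" using F_add[OF l l] by simp
  have D_eq: "D = nsum (\<lambda>x. wt (F l) x * wt (F l) (k - x))"
    unfolding D_def FF[symmetric] wt_mult ..
  have "0 < ennreal (e / 3) * D"
    using D0 e by (simp add: ennreal_zero_less_mult_iff)
  \<comment> \<open>The error e is shared in thirds by the midpoints outside \<open>Y\<close>, the
    spread over \<open>Y\<close>, and the ratio R / 2^q.\<close>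
  then obtain Y where Y: "finite Y"
    "nsum (\<lambda>x. wt (F l) x * wt (F l) (k - x) * indicator (- Y) x) < ennreal (e / 3) * D"
    using nsum_tail_small[of "\<lambda>x. wt (F l) x * wt (F l) (k - x)"] D0 D_eq by auto
  have "\<forall>\<^sub>F j in sequentially. survival j (card Y) < e / 3"
    using survival_tendsto_0 e by (intro order_tendstoD) auto
  then obtain R where R: "survival R (card Y) < e / 3"
    by (auto simp: eventually_sequentially)
  obtain q0 :: nat where q0: "3 * real R / e < 2 ^ q0"
    using real_arch_pow[of 2] by auto
  define q where "q = Suc q0"
  have q: "real R \<le> 2 ^ q * (e / 3)"
  proof -
    have "3 * real R / e < 2 ^ q" using q0 by (simp add: q_def) (smt (verit) zero_less_power)
    then show ?thesis using e by (simp add: field_simps)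
  qed
  show ?thesis
  proof
    show "q \<ge> 1" by (simp add: q_def)
    fix m :: nat and s assume m: "m \<ge> 1" and s: "s = l / (2 ^ q * real m)"
    define K :: nat where "K = 2 ^ q"
    have K: "K \<ge> 1" by (simp add: K_def)
    define A where "A = pair_equal (F s) ^ m"
    define B where "B = some_unequal (F s) m"
    have AB: "(A + B) ^ n = pair (F s) ^ (m * n)" for n
      by (simp add: A_def B_def pair_power_split[symmetric] power_mult)
    have "0 < s" using l m by (simp add: s)
    then have FsK: "F s ^ (m * K) = F l"
      using F_power[of s "m * K"] m K by (simp add: s K_def)
    have ABK: "(A + B) ^ K = pair (F l)"
      by (simp add: AB pair_power FsK)
    have "of_nat K * wt (total (B * (A + B) ^ (K - 1))) k
      \<le> of_nat R * D + of_nat K * (ennreal (survival R (card Y)) * D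
        + nsum (\<lambda>x. wt (F l) x * wt (F l) (k - x) * indicator (- Y) x))"
      using fixed_factor_bound[of B Y K A k R] spread_some_unequal[where f = "F s" and m = m] Y K
      unfolding ABK total_pair FF D_def by (simp add: pair_def B_def)
    also have "\<dots> \<le> ennreal (real K * (e / 3)) * D + of_nat K * (ennreal (e / 3) * D + ennreal (e / 3) * D)"
      using q R Y(2) by (intro add_mono mult_mono mult_right_mono ennreal_leI)
        (auto simp: K_def ennreal_of_nat_eq_real_of_nat intro!: ennreal_leI)
    also have "\<dots> = of_nat K * (ennreal e * D)"
    proof -
      have "ennreal e = ennreal (e / 3) + ennreal (e / 3) + ennreal (e / 3)"
        using e by (simp add: ennreal_plus[symmetric] del: ennreal_plus)
      moreover have "ennreal (real K * (e / 3)) = of_nat K * ennreal (e / 3)"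
        using e by (subst ennreal_mult) (auto simp: ennreal_of_nat_eq_real_of_nat)
      ultimately show ?thesis
        by (simp only: distrib_left distrib_right mult.assoc add.assoc)
    qed
    finally have "wt (total (B * (A + B) ^ (K - 1))) k \<le> ennreal e * D"
      using K by (subst (asm) ennreal_mult_le_mult_iff) auto
    then show "wt (total (some_unequal (F s) m * pair (F s) ^ (m * (2 ^ q - 1)))) k \<le> ennreal e * wt (F (2 * l)) k"
      unfolding AB by (simp add: B_def D_def K_def)
  qed
qed

lemma power_at_zero_eventual_bound:
  assumes l: "0 < l" and pos: "0 < wt (F (2 * l)) k"
  obtains c q b where "0 < c" "q \<ge> 1"
    "\<And>m. m > b \<Longrightarrow> c \<le> wt (F (l / (2 ^ q * real m))) 0 ^ (2 * m)"
proof -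
  define D where "D = wt (F (2 * l)) k"
  have D: "0 < D" "D < \<top>" using pos l F_finite[of "2 * l"] by (auto simp: D_def)
  obtain q where q: "q \<ge> 1" and small: "\<And>m s. m \<ge> 1 \<Longrightarrow> s = l / (2 ^ q * real m) \<Longrightarrow>
    wt (total (some_unequal (F s) m * pair (F s) ^ (m * (2 ^ q - 1)))) k \<le> ennreal (1 / 8) * D"
    using some_unequal_small[OF l pos, of "1 / 8"] unfolding D_def by auto
  define r where "r = l / 2 ^ q"
  have q2: "(2::real) ^ q \<ge> 2" using q self_le_power[of "2::real" q] by simp
  have r: "0 < r" "r < l" using l q2 by (auto simp: r_def field_simps)
  \<comment> \<open>If the first blocks of the two halves together contribute z, \<open>H z\<close>
    is the weight of reaching k in the remaining time.\<close>
  define H where "H z = wt (F (2 * l - 2 * r)) (k - z)" for z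
  have F_split: "F (2 * r) * F (2 * l - 2 * r) = F (2 * l)"
    using r F_add[of "2 * r" "2 * l - 2 * r"] by simp
  have sumD: "nsum (\<lambda>z. wt (F (2 * r)) z * H z) = D"
    unfolding D_def F_split[symmetric] wt_mult H_def ..
  have "0 < ennreal (1 / 8) * D"
    using D by (simp add: ennreal_zero_less_mult_iff)
  then obtain Y where Y: "finite Y"
    "nsum (\<lambda>z. wt (F (2 * r)) z * H z * indicator (- Y) z) < ennreal (1 / 8) * D"
    using nsum_tail_small[of "\<lambda>z. wt (F (2 * r)) z * H z"] D sumD by auto
  obtain b where b: "\<And>n w. n > b \<Longrightarrow> w \<noteq> 0 \<Longrightarrow> sum_list (replicate n w) \<notin> Y"
    using no_multiples[OF Y(1)] by blast
  have H0: "H 0 < \<top>" using F_finite r by (simp add: H_def)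
  \<comment> \<open>At least half of the weight of the bridges to k sits on those whose 2 m
    increments in the first pair of blocks are all 0.\<close>
  have main: "D \<le> 2 * (wt (F (l / (2 ^ q * real m))) 0 ^ (2 * m) * H 0)" if m: "m > b" for m
  proof -
    define s where "s = l / (2 ^ q * real m)"
    have m1: "m \<ge> 1" using m by simp
    have s: "0 < s" using l m1 by (simp add: s_def)
    have ms: "real m * s = r" using m1 by (simp add: s_def r_def)
    have Fm: "F s ^ m = F r" using F_power[OF s m1] ms by simp
    define n where "n = m * (2 ^ q - 1)"
    have n: "n \<ge> 1" using m1 self_le_power[of "2::nat" q] q by (simp add: n_def)
    have n2: "real (2 * n) * s = 2 * l - 2 * r"
    proof -
      have "real (2 * n) * s = 2 * (2 ^ q - 1) * (real m * s)"
        by (simp add: n_def of_nat_diff)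
      also have "\<dots> = 2 * (2 ^ q * r) - 2 * r"
        unfolding ms by (simp add: algebra_simps)
      finally show ?thesis by (simp add: r_def)
    qed
    have total_n: "total (pair (F s) ^ n) = F (2 * l - 2 * r)"
    proof -
      have "total (pair (F s) ^ n) = F s ^ (n + n)"
        unfolding pair_power total_pair power_add ..
      also have "\<dots> = F (real (2 * n) * s)"
        unfolding mult_2 using F_power[OF s, of "n + n"] n by linarith
      finally show ?thesis unfolding n2 .
    qed
    let ?g = "nsum (\<lambda>z. wt (total (pair_equal (F s)) ^ m) z * H z)"
    let ?u = "wt (total (some_unequal (F s) m * pair (F s) ^ n)) k"
    let ?h = "\<lambda>w. wt (F s) w ^ (2 * m) * H (sum_list (replicate (2 * m) w))"
    let ?G = "\<lambda>z. wt (F (2 * r)) z * H z * indicator (- Y) z"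
    have FF: "F s ^ m * F s ^ m = F (2 * r)"
      using Fm F_add[OF r(1) r(1)] by simp
    have "D = wt (total (pair (F s) ^ m * pair (F s) ^ n)) k"
      unfolding total_mult total_n unfolding pair_power total_pair FF F_split D_def ..
    also have "\<dots> = wt (total (pair_equal (F s) ^ m * pair (F s) ^ n)) k + ?u"
      by (simp only: pair_power_split[of "F s" m] distrib_right total_add wt_add)
    also have "wt (total (pair_equal (F s) ^ m * pair (F s) ^ n)) k = ?g"
      unfolding total_mult total_n unfolding total_power wt_mult H_def ..
    finally have split: "D = ?g + ?u" .
    have two: "2 * ?g \<le> D + nsum ?h"
      using equal_pairs_le[OF m1, of "F s" H] sumD by (simp add: FF)
    have "nsum ?h \<le> nsum (\<lambda>w. ?h 0 * indicator {0} w + ?h w * indicator (- {0}) w)"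
    proof (rule nsum_mono)
      fix w
      show "?h w \<le> ?h 0 * indicator {0} w + ?h w * indicator (- {0}) w"
        by (cases "w = 0") simp_all
    qed
    also have "\<dots> = nsum (\<lambda>w. ?h 0 * indicator {0 :: int ^ 'n} w) + nsum (\<lambda>w. ?h w * indicator (- {0}) w)"
      by (rule nsum_add)
    also have "nsum (\<lambda>w. ?h 0 * indicator {0 :: int ^ 'n} w) = ?h 0"
      by (subst nsum_single[of 0]) simp_all
    \<comment> \<open>Multiplication by 2 m is injective and carries nonzero w out of
      \<open>Y\<close>, so the tail absorbs all constant words other than that of zeros.\<close>
    also have "nsum (\<lambda>w. ?h w * indicator (- {0}) w) \<le> nsum ?G"
    proof (rule nsum_inj_le)
      show "inj (\<lambda>w :: int ^ 'n. sum_list (replicate (2 * m) w))"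
      proof (rule injI)
        fix v w :: "int ^ 'n"
        assume eq: "sum_list (replicate (2 * m) v) = sum_list (replicate (2 * m) w)"
        have "int (2 * m) * v $ i = int (2 * m) * w $ i" for i
          using arg_cong[OF eq, of "\<lambda>x. x $ i"] by (simp only: sum_list_replicate_nth)
        then show "v = w" using m1 by (simp add: vec_eq_iff)
      qed
      fix w
      show "?h w * indicator (- {0}) w \<le> ?G (sum_list (replicate (2 * m) w))"
      proof (cases "w = 0")
        case False
        have "wt (F s) w ^ (2 * m) \<le> wt (F (2 * r)) (sum_list (replicate (2 * m) w))"
          using wt_power_ge[of "F s" w "2 * m"] unfolding FF[symmetric] power_add[symmetric] mult_2[symmetric] .
        moreover have "sum_list (replicate (2 * m) w) \<notin> Y"
          using b[of "2 * m" w] m False by linarith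
        ultimately show ?thesis
          using False by (simp only: indicator_def Compl_iff singleton_iff if_True not_False_eq_True mult_1_right mult_right_mono zero_le)
      qed simp
    qed
    finally have const: "nsum ?h \<le> ?h 0 + nsum ?G"
      by (simp add: add_left_mono)
    have sum0: "sum_list (replicate (2 * m) (0 :: int ^ 'n)) = 0"
      by (simp add: vec_eq_iff sum_list_replicate_nth)
    have "D \<le> 2 * ?h 0"
    proof (rule ennreal_balance[OF two split _ const])
      show "?u \<le> ennreal (1 / 8) * D"
        using small[OF m1 s_def] unfolding n_def .
      show "nsum ?G \<le> ennreal (1 / 8) * D" using Y by simp
      show "?h 0 < \<top>"
        unfolding sum0 using F_finite[OF s] H0 by (simp add: ennreal_mult_less_top power_less_top_ennreal)
    qed (use D in auto)
    then show ?thesis unfolding sum0 s_def .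
  qed
  define c where "c = D / (2 * H 0)"
  show ?thesis
  proof
    have "0 < H 0" using main[of "Suc b"] D by (auto simp: zero_less_iff_neq_zero)
    then show "0 < c" using D H0 by (auto simp: c_def ennreal_zero_less_divide ennreal_mult_less_top)
    show "q \<ge> 1" by fact
    fix m assume "m > b"
    from main[OF this] show "c \<le> wt (F (l / (2 ^ q * real m))) 0 ^ (2 * m)"
      using H0 \<open>0 < H 0\<close> unfolding c_def
      by (auto intro!: divide_le_posI_ennreal simp: ennreal_zero_less_mult_iff ac_simps)
  qed
qed

text \<open>Two zero half-steps make one zero step, so the powers decrease under refinement, and a
  bound along arbitrarily fine meshes holds for every mesh.\<close>

lemma power_at_zero_lower_bound:
  assumes l: "0 < l" and pos: "0 < wt (F (2 * l)) k"
  obtains c where "0 < c" "\<And>n. c \<le> wt (F (l / 2 ^ n)) 0 ^ (2 ^ n)"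
proof -
  obtain c q b where c: "0 < c" and q: "q \<ge> 1"
    and bound: "\<And>m. m > b \<Longrightarrow> c \<le> wt (F (l / (2 ^ q * real m))) 0 ^ (2 * m)"
    using power_at_zero_eventual_bound[OF assms] by blast
  define g where "g n = wt (F (l / 2 ^ n)) 0 ^ (2 ^ n)" for n
  have dec: "g (Suc n) \<le> g n" for n
  proof -
    have "wt (F (l / 2 ^ Suc n)) 0 ^ 2 \<le> wt (F (l / 2 ^ n)) 0"
      using wt_mult_ge[of "F (l / 2 ^ Suc n)" 0 "F (l / 2 ^ Suc n)" 0] F_add[of "l / 2 ^ Suc n" "l / 2 ^ Suc n"] l
      by (simp add: power2_eq_square)
    then show ?thesis
      unfolding g_def by (simp add: power_mult power_mono)
  qed
  have "c ^ 2 ^ (q - 1) \<le> g n" for n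
  proof -
    define N where "N = max n (b + 1)"
    have "b < 2 ^ (b + 1)" by (induction b) auto
    also have "(2::nat) ^ (b + 1) \<le> 2 ^ N" by (intro power_increasing) (auto simp: N_def)
    finally have "c \<le> wt (F (l / (2 ^ q * real (2 ^ N)))) 0 ^ (2 * 2 ^ N)" by (rule bound)
    then have "c ^ 2 ^ (q - 1) \<le> (wt (F (l / (2 ^ q * real (2 ^ N)))) 0 ^ (2 * 2 ^ N)) ^ 2 ^ (q - 1)"
      by (rule power_mono) simp
    also have "\<dots> = g (q + N)"
    proof -
      \<comment> \<open>The bound covers a single pair of blocks, of 2 * 2^N steps; the power 2^(q -
        1) extends it to all 2^(q + N) steps of time l. Here \<open>q \<ge> 1\<close>
        enters.\<close>
      have "2 * 2 ^ N * 2 ^ (q - 1) = (2::nat) ^ (q + N)"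
        using q by (cases q) (simp_all add: power_add)
      moreover have "(2::real) ^ q * real (2 ^ N) = 2 ^ (q + N)"
        by (simp add: power_add)
      ultimately show ?thesis
        by (simp only: g_def power_mult[symmetric])
    qed
    also have "\<dots> \<le> g n"
      using lift_Suc_antimono_le[of g, OF dec] by (simp add: N_def)
    finally show ?thesis .
  qed
  moreover have "0 < c ^ 2 ^ (q - 1)" using c by (simp add: zero_less_iff_neq_zero)
  ultimately show ?thesis using that unfolding g_def by blast
qed

end

section \<open>The compound Poisson representation\<close>

lemma choose_over_power_tendsto:
  "(\<lambda>n. real (2 ^ n choose m) / (2 ^ n) ^ m) \<longlonglongrightarrow> 1 / fact m"
proof -
  have lim: "(\<lambda>n. (1 - real i / 2 ^ n) / real (m - i)) \<longlonglongrightarrow> 1 / real (m - i)" if "i < m" for i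
  proof -
    have "(\<lambda>n. real i * (1 / 2) ^ n) \<longlonglongrightarrow> real i * 0"
      by (intro tendsto_mult tendsto_const LIMSEQ_realpow_zero) auto
    then have "(\<lambda>n. (1 - real i * (1 / 2) ^ n) / real (m - i)) \<longlonglongrightarrow> (1 - real i * 0) / real (m - i)"
      by (intro tendsto_divide tendsto_diff tendsto_const) (use that in auto)
    moreover have "real i * (1 / 2) ^ n = real i / 2 ^ n" for n
      by (simp add: power_one_over)
    ultimately show ?thesis by simp
  qed
  have "(\<lambda>n. \<Prod>i = 0..<m. (1 - real i / 2 ^ n) / real (m - i)) \<longlonglongrightarrow> (\<Prod>i = 0..<m. 1 / real (m - i))"
    by (intro tendsto_prod lim) auto
  also have "(\<Prod>i = 0..<m. 1 / real (m - i)) = 1 / fact m"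
    by (simp add: prod_dividef fact_prod_rev)
  finally have "(\<lambda>n. \<Prod>i = 0..<m. (1 - real i / 2 ^ n) / real (m - i)) \<longlonglongrightarrow> 1 / fact m" .
  moreover have "\<forall>\<^sub>F n in sequentially. (\<Prod>i = 0..<m. (1 - real i / 2 ^ n) / real (m - i))
      = real (2 ^ n choose m) / (2 ^ n) ^ m"
    using eventually_ge_at_top[of m]
  proof eventually_elim
    case (elim n)
    have "m \<le> 2 ^ n" using elim less_exp[of n] by linarith
    then have eq: "real (2 ^ n choose m) = (\<Prod>i = 0..<m. real (2 ^ n - i) / real (m - i))"
      by (rule binomial_altdef_of_nat)
    have "real (2 ^ n choose m) / (2 ^ n) ^ m = (\<Prod>i = 0..<m. real (2 ^ n - i) / real (m - i) / 2 ^ n)"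
      by (simp only: eq prod_dividef prod_constant card_atLeastLessThan diff_zero)
    also have "\<dots> = (\<Prod>i = 0..<m. (1 - real i / 2 ^ n) / real (m - i))"
      using \<open>m \<le> 2 ^ n\<close> by (intro prod.cong) (auto simp: of_nat_diff field_simps)
    finally show ?case ..
  qed
  ultimately show ?thesis by (rule Lim_transform_eventually)
qed

text \<open>Each factor satisfies 2 (N - i) \<le> 2 N - i. The gain 2^m later supplies a majorant
  that is geometric in the number m of jumps.\<close>

lemma choose_double: "2 ^ m * (N choose m) \<le> (2 * N) choose m"
proof (cases "m \<le> N")
  case True
  have "real (2 ^ m * (N choose m)) = 2 ^ m * (\<Prod>i = 0..<m. real (N - i) / real (m - i))"
    by (simp only: binomial_altdef_of_nat[OF True, where 'a = real] of_nat_mult of_nat_power of_nat_numeral)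
  also have "\<dots> = (\<Prod>i = 0..<m. 2 * (real (N - i) / real (m - i)))"
    by (simp only: prod.distrib prod_constant card_atLeastLessThan diff_zero)
  also have "\<dots> \<le> (\<Prod>i = 0..<m. real (2 * N - i) / real (m - i))"
  proof (intro prod_mono conjI)
    fix i assume "i \<in> {0..<m}"
    then have "2 * real (N - i) \<le> real (2 * N - i)"
      using True by (simp add: of_nat_diff)
    then show "2 * (real (N - i) / real (m - i)) \<le> real (2 * N - i) / real (m - i)"
      unfolding times_divide_eq_right by (rule divide_right_mono) simp
  qed simp
  also have "\<dots> = real ((2 * N) choose m)"
    using binomial_altdef_of_nat[of m "2 * N", where 'a = real] True by simp
  finally show ?thesis by (simp only: of_nat_le_iff)
qed (simp add: binomial_eq_0)

locale nonzero_lattice_semigroup = lattice_semigroup +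
  assumes F_nonzero: "0 < a \<Longrightarrow> \<exists>k. wt (F a) k \<noteq> 0"
begin

definition f :: "real \<Rightarrow> int ^ 'a \<Rightarrow> real"
  where "f a x = enn2real (wt (F a) x)"

lemma wt_F: "0 < a \<Longrightarrow> wt (F a) x = ennreal (f a x)"
  using F_finite[of a x] by (simp add: f_def)

lemma f_nonneg: "0 \<le> f a x"
  by (simp add: f_def)

lemma f_mult_ge: "0 < a \<Longrightarrow> 0 < b \<Longrightarrow> f a x * f b y \<le> f (a + b) (x + y)"
  using wt_mult_ge[of "F a" x "F b" y]
  by (simp add: F_add wt_F ennreal_mult[symmetric] f_nonneg)

text \<open>Only the decompositions 0 + x and x + 0 are kept; they are distinct because x \<noteq>
  0.\<close>

lemma f_superadditive:
  assumes "0 < a" "0 < b" "x \<noteq> 0"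
  shows "f a x * f b 0 + f a 0 * f b x \<le> f (a + b) x"
proof -
  have "(\<Sum>y\<in>{0, x}. wt (F a) y * wt (F b) (x - y)) \<le> wt (F a * F b) x"
    unfolding wt_mult by (rule nsum_ge_sum) simp
  then have "ennreal (f a x * f b 0 + f a 0 * f b x) \<le> ennreal (f (a + b) x)"
    using assms
    by (simp add: F_add wt_F ennreal_mult[symmetric] f_nonneg add.commute ennreal_plus[symmetric] del: ennreal_plus)
  then show ?thesis by (simp only: ennreal_le_iff[OF f_nonneg])
qed

definition gam :: "real \<Rightarrow> nat \<Rightarrow> real"
  where "gam a n = f (a / 2 ^ n) 0 ^ 2 ^ n"

text \<open>The odds of an increment x against 0 in one step, times the number of steps: a discrete
  jump intensity in which a scalar factor of the semigroup cancels.\<close>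

definition nu :: "real \<Rightarrow> nat \<Rightarrow> int ^ 'a \<Rightarrow> real"
  where "nu a n x = (if x = 0 then 0 else 2 ^ n * f (a / 2 ^ n) x / f (a / 2 ^ n) 0)"

lemma gam_lower_bound:
  assumes a: "0 < a"
  obtains c where "0 < c" "\<And>n. c \<le> gam a n"
proof -
  obtain k where "0 < wt (F (2 * a)) k"
    using F_nonzero[of "2 * a"] a by (auto simp: zero_less_iff_neq_zero)
  then obtain c where c: "0 < c" "\<And>n. c \<le> wt (F (a / 2 ^ n)) 0 ^ (2 ^ n)"
    using power_at_zero_lower_bound a by blast
  have c': "c \<le> ennreal (gam a n)" for n
    using c(2)[of n] a by (simp add: gam_def wt_F f_nonneg ennreal_power)
  have fin: "c < \<top>" using c'[of 0] by (rule le_less_trans) simp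
  show ?thesis
  proof
    show "0 < enn2real c" using c(1) fin by (simp add: enn2real_positive_iff)
    show "enn2real c \<le> gam a n" for n
      using c'[of n] by (simp add: enn2real_leI gam_def f_nonneg)
  qed
qed

lemma f_zero_pos: "0 < a \<Longrightarrow> 0 < f a 0"
proof -
  assume "0 < a"
  then obtain c where "0 < c" "\<And>n. c \<le> gam a n" using gam_lower_bound by blast
  then have "0 < gam a 0" by (meson less_le_trans)
  then show ?thesis by (simp add: gam_def)
qed

lemma nu_nonneg: "0 \<le> nu a n x"
  by (simp add: nu_def f_nonneg)

lemma gam_pos: "0 < a \<Longrightarrow> 0 < gam a n"
  by (simp add: gam_def f_zero_pos)

lemma f_half: "0 < a \<Longrightarrow> f (a / 2 ^ Suc n) x * f (a / 2 ^ Suc n) y \<le> f (a / 2 ^ n) (x + y)"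
  using f_mult_ge[of "a / 2 ^ Suc n" "a / 2 ^ Suc n" x y] by simp

lemma gam_decseq:
  assumes a: "0 < a"
  shows "decseq (gam a)"
proof (rule decseq_SucI)
  fix n
  have "gam a (Suc n) = (f (a / 2 ^ Suc n) 0 * f (a / 2 ^ Suc n) 0) ^ 2 ^ n"
    by (simp add: gam_def power_mult power2_eq_square)
  also have "\<dots> \<le> gam a n"
    using f_half[OF a, of n 0 0] by (simp add: gam_def f_nonneg power_mono)
  finally show "gam a (Suc n) \<le> gam a n" .
qed

text \<open>\<open>gam a n * nu a n x\<close> is the weight of exactly one nonzero increment, equal to \<open>x\<close>.\<close>

lemma gam_nu:
  assumes "0 < a" "x \<noteq> 0"
  shows "gam a n * nu a n x = 2 ^ n * f (a / 2 ^ n) x * f (a / 2 ^ n) 0 ^ (2 ^ n - 1)"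
  using f_zero_pos[of "a / 2 ^ n"] assms
  by (simp add: gam_def nu_def power_eq_if[of _ "2 ^ n"])

text \<open>A path with exactly one nonzero fine increment has exactly one nonzero coarse increment,
  so refinement lowers the weight.\<close>

lemma gam_nu_decseq:
  assumes a: "0 < a"
  shows "decseq (\<lambda>n. gam a n * nu a n x)"
proof (cases "x = 0")
  case False
  show ?thesis
  proof (rule decseq_SucI)
    fix n
    let ?h = "a / 2 ^ Suc n" and ?s = "a / 2 ^ n"
    \<comment> \<open>Of the zero fine steps, one shares its coarse step with the jump; the others
      fill 2^n - 1 coarse steps in twos.\<close>
    have pow: "(2::nat) ^ Suc n - 1 = Suc (2 * (2 ^ n - 1))"
      using one_le_power[of "2::nat" n] unfolding power_Suc by arith
    have "gam a (Suc n) * nu a (Suc n) x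
        = 2 ^ n * (2 * (f ?h x * f ?h 0)) * (f ?h 0 * f ?h 0) ^ (2 ^ n - 1)"
      unfolding gam_nu[OF a False] pow by (simp add: power_mult power2_eq_square)
    also have "\<dots> \<le> 2 ^ n * f ?s x * f ?s 0 ^ (2 ^ n - 1)"
    proof (intro mult_mono mult_left_mono power_mono)
      show "2 * (f ?h x * f ?h 0) \<le> f ?s x"
        using f_superadditive[of ?h ?h x] a False by (simp add: mult.commute)
      show "f ?h 0 * f ?h 0 \<le> f ?s 0"
        using f_half[OF a, of n 0 0] by simp
    qed (auto simp: f_nonneg)
    also have "\<dots> = gam a n * nu a n x"
      unfolding gam_nu[OF a False] ..
    finally show "gam a (Suc n) * nu a (Suc n) x \<le> gam a n * nu a n x" .
  qed
qed (simp add: nu_def decseq_def)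

definition gam_lim :: "real \<Rightarrow> real"
  where "gam_lim a = lim (gam a)"

definition jump :: "real \<Rightarrow> int ^ 'a \<Rightarrow> real"
  where "jump a x = lim (\<lambda>n. nu a n x)"

lemma decseq_nonneg_convergent:
  fixes u :: "nat \<Rightarrow> real"
  assumes "decseq u" "\<And>n. 0 \<le> u n"
  shows "convergent u"
proof -
  obtain L where "u \<longlonglongrightarrow> L" using decseq_convergent[OF assms(1), of 0] assms(2) by blast
  then show ?thesis by (auto simp: convergent_def)
qed

lemma gam_tendsto: "0 < a \<Longrightarrow> gam a \<longlonglongrightarrow> gam_lim a"
  using decseq_nonneg_convergent[OF gam_decseq] gam_pos
  by (simp add: gam_lim_def convergent_LIMSEQ_iff less_imp_le)

lemma gam_lim_pos:
  assumes "0 < a"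
  shows "0 < gam_lim a"
proof -
  obtain c where c: "0 < c" "\<And>n. c \<le> gam a n" using gam_lower_bound[OF assms] by blast
  have "c \<le> gam_lim a"
    using gam_tendsto[OF assms] c(2) by (intro LIMSEQ_le_const) auto
  with c show ?thesis by simp
qed

lemma nu_tendsto:
  assumes a: "0 < a"
  shows "(\<lambda>n. nu a n x) \<longlonglongrightarrow> jump a x"
proof -
  have "convergent (\<lambda>n. gam a n * nu a n x)"
    by (rule decseq_nonneg_convergent[OF gam_nu_decseq[OF a]])
      (simp add: nu_nonneg gam_pos a less_imp_le)
  then obtain L where "(\<lambda>n. gam a n * nu a n x) \<longlonglongrightarrow> L" by (auto simp: convergent_def)
  then have "(\<lambda>n. gam a n * nu a n x / gam a n) \<longlonglongrightarrow> L / gam_lim a"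
    using gam_tendsto[OF a] gam_lim_pos[OF a] by (intro tendsto_divide) auto
  moreover have "gam a n * nu a n x / gam a n = nu a n x" for n
    using gam_pos[OF a, of n] by simp
  ultimately have "convergent (\<lambda>n. nu a n x)" by (auto simp: convergent_def)
  then show ?thesis by (simp add: jump_def convergent_LIMSEQ_iff)
qed

lemma jump_nonneg: "0 < a \<Longrightarrow> 0 \<le> jump a x"
  using LIMSEQ_le_const[OF nu_tendsto] nu_nonneg by blast

text \<open>\<open>gam\<close> lies above its limit, and its product with \<open>nu\<close> below
  the value at n = 0. The resulting majorant is uniform in n, as dominated convergence
  requires.\<close>

lemma nu_le:
  assumes a: "0 < a"
  shows "nu a n x \<le> f a x / gam_lim a"
proof (cases "x = 0")
  case False
  have "gam_lim a * nu a n x \<le> gam a n * nu a n x"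
    using decseq_ge[OF gam_decseq[OF a] gam_tendsto[OF a]] nu_nonneg by (intro mult_right_mono) auto
  also have "\<dots> \<le> gam a 0 * nu a 0 x"
    using gam_nu_decseq[OF a, of x] by (simp add: decseq_def)
  also have "\<dots> = f a x" using gam_nu[OF a False, of 0] by simp
  finally show ?thesis using gam_lim_pos[OF a] by (simp add: field_simps)
qed (simp add: nu_def f_nonneg gam_lim_pos[OF a] less_imp_le)

definition nu_weights :: "real \<Rightarrow> nat \<Rightarrow> (int ^ 'a) weights"
  where "nu_weights a n = Weights (\<lambda>x. ennreal (nu a n x))"

definition jump_weights :: "real \<Rightarrow> (int ^ 'a) weights"
  where "jump_weights a = Weights (\<lambda>x. ennreal (jump a x))"

text \<open>One step is a scalar times 1 + nu / 2^n, so \<open>F a\<close> is a scalar times the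
  2^n-th power of this: the product formula for the exponential.\<close>

lemma F_step_eq:
  assumes a: "0 < a"
  shows "F (a / 2 ^ n) = const_weights (ennreal (f (a / 2 ^ n) 0)) *
    (1 + const_weights (ennreal (1 / 2 ^ n)) * nu_weights a n)"
proof (rule weights_eqI)
  fix x
  have "0 < f (a / 2 ^ n) 0" using f_zero_pos[of "a / 2 ^ n"] a by simp
  then show "wt (F (a / 2 ^ n)) x = wt (const_weights (ennreal (f (a / 2 ^ n) 0)) *
    (1 + const_weights (ennreal (1 / 2 ^ n)) * nu_weights a n)) x"
    using a by (auto simp: wt_F wt_one nu_weights_def nu_def f_nonneg ennreal_mult[symmetric])
qed

lemma F_step_power:
  assumes a: "0 < a"
  shows "wt (F (a / 2 ^ n) ^ N) x = ennreal (f (a / 2 ^ n) 0 ^ N) *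
    (\<Sum>m\<le>N. ennreal (real (N choose m) / (2 ^ n) ^ m) * wt (nu_weights a n ^ m) x)"
proof -
  have "F (a / 2 ^ n) ^ N = const_weights (ennreal (f (a / 2 ^ n) 0 ^ N)) *
      (const_weights (ennreal (1 / 2 ^ n)) * nu_weights a n + 1) ^ N"
    by (subst F_step_eq[OF a])
      (simp only: power_mult_distrib const_weights_power ennreal_power f_nonneg add.commute)
  also have "(const_weights (ennreal (1 / 2 ^ n)) * nu_weights a n + 1) ^ N =
      (\<Sum>m\<le>N. of_nat (N choose m) * (const_weights (ennreal ((1 / 2 ^ n) ^ m)) * nu_weights a n ^ m))"
    by (simp add: binomial_ring power_mult_distrib const_weights_power ennreal_power mult.assoc)
  finally have F_pow: "F (a / 2 ^ n) ^ N = const_weights (ennreal (f (a / 2 ^ n) 0 ^ N)) *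
      (\<Sum>m\<le>N. of_nat (N choose m) * (const_weights (ennreal ((1 / 2 ^ n) ^ m)) * nu_weights a n ^ m))" .
  have coeff: "of_nat c * (ennreal ((1 / 2 ^ n) ^ m) * w) = ennreal (real c / (2 ^ n) ^ m) * w" for c m w
    by (simp add: ennreal_of_nat_eq_real_of_nat mult.assoc[symmetric] ennreal_mult[symmetric] power_one_over)
  show ?thesis
    by (simp only: F_pow wt_const_mult wt_sum wt_of_nat_mult coeff)
qed

lemma nu_weights_power_le:
  assumes a: "0 < a"
  shows "wt (nu_weights a n ^ m) x \<le> wt ((const_weights (ennreal (1 / gam_lim a)) * F a) ^ m) x"
proof (rule wt_power_mono)
  fix y
  show "wt (nu_weights a n) y \<le> wt (const_weights (ennreal (1 / gam_lim a)) * F a) y"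
    using nu_le[OF a, of n y] gam_lim_pos[OF a] a
    by (simp add: nu_weights_def wt_F ennreal_mult[symmetric] f_nonneg)
qed

text \<open>For m \<ge> 1, \<open>F a ^ m\<close> is the semigroup at time m a, hence finite at each
  point even if the total mass is infinite.\<close>

lemma dominating_power_finite:
  assumes a: "0 < a"
  shows "wt ((const_weights (ennreal c) * F a) ^ m) x < \<top>"
proof (cases "m = 0")
  case False
  then have "F a ^ m = F (real m * a)" using F_power[OF a] by simp
  then have "wt ((const_weights (ennreal c) * F a) ^ m) x = ennreal c ^ m * wt (F (real m * a)) x"
    by (simp only: power_mult_distrib const_weights_power wt_const_mult)
  moreover have "wt (F (real m * a)) x < \<top>" using a False by (intro F_finite) simp
  ultimately show ?thesis
    by (simp add: ennreal_mult_less_top power_less_top_ennreal)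
qed (simp add: wt_one)

lemma nu_weights_power_tendsto:
  assumes a: "0 < a"
  shows "(\<lambda>n. wt (nu_weights a n ^ m) x) \<longlonglongrightarrow> wt (jump_weights a ^ m) x"
proof (induction m arbitrary: x)
  case (Suc m)
  define M where "M = const_weights (ennreal (1 / gam_lim a)) * F a"
  have fin: "wt (M ^ j) y < \<top>" for j y
    unfolding M_def by (rule dominating_power_finite[OF a])
  have le: "wt (nu_weights a n ^ j) y \<le> wt (M ^ j) y" for n j y
    unfolding M_def by (rule nu_weights_power_le[OF a])
  have lim1: "(\<lambda>n. wt (nu_weights a n) y) \<longlonglongrightarrow> wt (jump_weights a) y" for y
    using nu_tendsto[OF a] by (simp add: nu_weights_def jump_weights_def)
  have le_lim1: "wt (jump_weights a) y \<le> wt M y" for y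
    by (rule LIMSEQ_le_const2[OF lim1]) (use le[of _ 1] in auto)
  have le_lim: "wt (jump_weights a ^ m) y \<le> wt (M ^ m) y" for y
    by (rule LIMSEQ_le_const2[OF Suc.IH]) (use le in auto)
  have "(\<lambda>n. nsum (\<lambda>y. wt (nu_weights a n) y * wt (nu_weights a n ^ m) (x - y)))
      \<longlonglongrightarrow> nsum (\<lambda>y. wt (jump_weights a) y * wt (jump_weights a ^ m) (x - y))"
  proof (rule nn_integral_dominated_convergence[where w = "\<lambda>y. wt M y * wt (M ^ m) (x - y)"])
    show "AE y in count_space UNIV. wt (nu_weights a n) y * wt (nu_weights a n ^ m) (x - y)
        \<le> wt M y * wt (M ^ m) (x - y)" for n
      using le[of n 1] le[of n m] by (auto intro!: mult_mono)
    show "nsum (\<lambda>y. wt M y * wt (M ^ m) (x - y)) < \<infinity>"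
      using fin[of "Suc m" x] by (simp add: wt_mult)
    show "AE y in count_space UNIV. (\<lambda>n. wt (nu_weights a n) y * wt (nu_weights a n ^ m) (x - y))
        \<longlonglongrightarrow> wt (jump_weights a) y * wt (jump_weights a ^ m) (x - y)"
    proof (intro AE_I2)
      fix y
      have "wt (jump_weights a) y < \<top>" "wt (jump_weights a ^ m) (x - y) < \<top>"
        using le_less_trans[OF le_lim1 fin[of 1, simplified]] le_less_trans[OF le_lim fin] by auto
      then show "(\<lambda>n. wt (nu_weights a n) y * wt (nu_weights a n ^ m) (x - y))
          \<longlonglongrightarrow> wt (jump_weights a) y * wt (jump_weights a ^ m) (x - y)"
        by (intro tendsto_mult_ennreal lim1 Suc.IH) auto
    qed
  qed auto
  then show ?case by (simp add: wt_mult)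
qed simp

lemma exponential_series:
  assumes a: "0 < a"
  shows "wt (F a) x = nsum (\<lambda>m. ennreal (gam_lim a / fact m) * wt (jump_weights a ^ m) x)"
proof -
  define t where "t n m = ennreal (gam a n * (real (2 ^ n choose m) / (2 ^ n) ^ m)) * wt (nu_weights a n ^ m) x" for n m
  \<comment> \<open>The majorant comes from time 2 a, whose term with m jumps exceeds that of time a
    by a factor of at least 2^m times \<open>gam a n\<close>, and \<open>gam a n\<close> is at least
    \<open>gam_lim a\<close>.\<close>
  define w where "w m = ennreal ((1 / 2) ^ m) * ennreal (f (2 * a) x / gam_lim a)" for m :: nat
  have F_root: "F (a / 2 ^ n) ^ 2 ^ n = F a" "F (a / 2 ^ n) ^ (2 * 2 ^ n) = F (2 * a)" for n
  proof -
    have pos: "0 < a / 2 ^ n" using a by simp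
    have "real (2 ^ n) * (a / 2 ^ n) = a" "real (2 * 2 ^ n) * (a / 2 ^ n) = 2 * a"
      by simp_all
    then show "F (a / 2 ^ n) ^ 2 ^ n = F a" "F (a / 2 ^ n) ^ (2 * 2 ^ n) = F (2 * a)"
      using F_power[OF pos, of "2 ^ n"] F_power[OF pos, of "2 * 2 ^ n"]
      by (simp_all only: one_le_power one_le_mult_iff simp_thms) simp_all
  qed
  have coeff: "ennreal (gam a n * r) = ennreal (gam a n) * ennreal r" for n r
    using gam_pos[OF a, of n] by (simp add: ennreal_mult')
  have sum_t: "nsum (t n) = wt (F a) x" for n
  proof -
    have "nsum (t n) = (\<Sum>m\<le>2 ^ n. t n m)"
      by (rule nn_integral_count_space') (auto simp: t_def binomial_eq_0)
    also have "\<dots> = wt (F (a / 2 ^ n) ^ 2 ^ n) x"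
      unfolding F_step_power[OF a] sum_distrib_left
      by (intro sum.cong refl) (simp only: t_def gam_def[symmetric] coeff mult.assoc)
    finally show ?thesis unfolding F_root .
  qed
  have t_le: "t n m \<le> w m" for n m
  proof (cases "m \<le> 2 ^ n")
    case True
    let ?N = "2 ^ n :: nat" and ?W = "wt (nu_weights a n ^ m) x"
    have fin: "?W < \<top>"
      using nu_weights_power_le[OF a] dominating_power_finite[OF a] by (rule le_less_trans)
    define v where "v = enn2real ?W"
    have v: "?W = ennreal v" "0 \<le> v" using fin by (auto simp: v_def)
    have "ennreal (gam a n ^ 2) * (ennreal (real (2 * ?N choose m) / (2 ^ n) ^ m) * ?W)
        \<le> ennreal (gam a n ^ 2) * (\<Sum>m\<le>2 * ?N. ennreal (real (2 * ?N choose m) / (2 ^ n) ^ m) * wt (nu_weights a n ^ m) x)"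
      using True by (intro mult_left_mono member_le_sum) auto
    also have "\<dots> = wt (F (a / 2 ^ n) ^ (2 * 2 ^ n)) x"
      unfolding F_step_power[OF a] gam_def by (simp add: power_mult[symmetric] mult.commute)
    also have "\<dots> = ennreal (f (2 * a) x)"
      unfolding F_root using a by (simp add: wt_F)
    finally have "gam a n ^ 2 * (real (2 * ?N choose m) / (2 ^ n) ^ m * v) \<le> f (2 * a) x"
      using f_nonneg[of "2 * a" x] v by (simp add: ennreal_mult[symmetric])
    moreover have "real (2 ^ m * (?N choose m)) \<le> real (2 * ?N choose m)"
      by (simp only: of_nat_le_iff choose_double)
    then have "2 ^ m * real (?N choose m) \<le> real (2 * ?N choose m)"
      by (simp only: of_nat_mult of_nat_power of_nat_numeral)
    then have "gam a n ^ 2 * (2 ^ m * real (?N choose m) / (2 ^ n) ^ m * v)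
        \<le> gam a n ^ 2 * (real (2 * ?N choose m) / (2 ^ n) ^ m * v)"
      using v by (intro mult_left_mono mult_right_mono divide_right_mono) auto
    ultimately have le: "gam a n * (2 ^ m * (gam a n * (real (?N choose m) / (2 ^ n) ^ m) * v)) \<le> f (2 * a) x"
      by (simp add: power2_eq_square mult_ac)
    have "gam_lim a * (2 ^ m * (gam a n * (real (?N choose m) / (2 ^ n) ^ m) * v)) \<le> f (2 * a) x"
    proof (rule order.trans[OF mult_right_mono le])
      show "gam_lim a \<le> gam a n"
        using decseq_ge[OF gam_decseq[OF a] gam_tendsto[OF a]] .
    qed (use v gam_pos[OF a, of n] in simp)
    then have "gam a n * (real (?N choose m) / (2 ^ n) ^ m) * v \<le> (1 / 2) ^ m * (f (2 * a) x / gam_lim a)"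
      using gam_lim_pos[OF a] by (simp add: field_simps power_one_over)
    then show ?thesis
      using v gam_pos[OF a, of n] gam_lim_pos[OF a] f_nonneg[of "2 * a" x]
      by (simp add: t_def w_def ennreal_mult[symmetric] less_imp_le)
  qed (simp add: t_def binomial_eq_0)
  have "(\<lambda>n. nsum (t n)) \<longlonglongrightarrow> nsum (\<lambda>m. ennreal (gam_lim a / fact m) * wt (jump_weights a ^ m) x)"
  proof (rule nn_integral_dominated_convergence[where w = w])
    show "nsum w < \<infinity>"
    proof -
      have "nsum (\<lambda>m. ennreal ((1 / 2) ^ m)) = ennreal (\<Sum>m. (1 / 2) ^ m)"
        unfolding nn_integral_count_space_nat by (rule suminf_ennreal2) auto
      moreover have "nsum w = nsum (\<lambda>m. ennreal ((1 / 2) ^ m)) * ennreal (f (2 * a) x / gam_lim a)"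
        unfolding w_def[abs_def] by (rule nsum_multc)
      ultimately show ?thesis by (simp add: ennreal_mult_less_top)
    qed
    show "AE m in count_space UNIV. (\<lambda>n. t n m) \<longlonglongrightarrow> ennreal (gam_lim a / fact m) * wt (jump_weights a ^ m) x"
    proof (intro AE_I2)
      fix m
      have lim: "(\<lambda>n. ennreal (gam a n * (real (2 ^ n choose m) / (2 ^ n) ^ m))) \<longlonglongrightarrow> ennreal (gam_lim a * (1 / fact m))"
        by (intro tendsto_ennrealI tendsto_mult gam_tendsto a choose_over_power_tendsto)
      have "0 < ennreal (gam_lim a * (1 / fact m))" using gam_lim_pos[OF a] by simp
      then have "(\<lambda>n. t n m) \<longlonglongrightarrow> ennreal (gam_lim a * (1 / fact m)) * wt (jump_weights a ^ m) x"
        unfolding t_def by (intro tendsto_mult_ennreal[OF lim nu_weights_power_tendsto[OF a]]) auto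
      then show "(\<lambda>n. t n m) \<longlonglongrightarrow> ennreal (gam_lim a / fact m) * wt (jump_weights a ^ m) x"
        by simp
    qed
  qed (use t_le in auto)
  then show ?thesis
    unfolding sum_t LIMSEQ_const_iff .
qed

section \<open>Linearity of the jump measure in time\<close>

lemma jump_dyadic:
  assumes "0 < a"
  shows "jump (a / 2 ^ q) x = jump a x / 2 ^ q"
proof -
  have "nu (a / 2 ^ q) n x = nu a (n + q) x / 2 ^ q" for n
    by (simp add: nu_def power_add mult.commute)
  then have "(\<lambda>n. nu (a / 2 ^ q) n x) \<longlonglongrightarrow> jump a x / 2 ^ q"
    using LIMSEQ_ignore_initial_segment[OF nu_tendsto[OF assms, of x], of q] by (simp add: tendsto_divide)
  moreover have "(\<lambda>n. nu (a / 2 ^ q) n x) \<longlonglongrightarrow> jump (a / 2 ^ q) x"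
    using nu_tendsto[of "a / 2 ^ q"] assms by simp
  ultimately show ?thesis using LIMSEQ_unique by blast
qed

text \<open>The values are 2^n-th roots of \<open>gam a n\<close>, which stays between two positive
  constants. The limit is along a / 2^n only, where even an irregular scalar g is tame.\<close>

lemma f_zero_tendsto:
  assumes a: "0 < a"
  shows "(\<lambda>n. f (a / 2 ^ n) 0) \<longlonglongrightarrow> 1"
proof -
  have root_eq: "f (a / 2 ^ n) 0 = root (2 ^ n) (gam a n)" for n
    using f_zero_pos[of "a / 2 ^ n"] a by (simp add: gam_def real_root_power_cancel)
  have sub: "strict_mono (\<lambda>n. 2 ^ n :: nat)" by (rule strict_monoI) simp
  have const: "(\<lambda>n. root (2 ^ n) c) \<longlonglongrightarrow> 1" if "0 < c" for c
    using LIMSEQ_subseq_LIMSEQ[OF LIMSEQ_root_const[OF that] sub] by (simp add: o_def)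
  show ?thesis
  proof (rule tendsto_sandwich[OF _ _ const[OF gam_lim_pos[OF a]] const[OF gam_pos[OF a, of 0]]])
    show "\<forall>\<^sub>F n in sequentially. root (2 ^ n) (gam_lim a) \<le> f (a / 2 ^ n) 0"
      using decseq_ge[OF gam_decseq[OF a] gam_tendsto[OF a]] by (simp add: root_eq)
    show "\<forall>\<^sub>F n in sequentially. f (a / 2 ^ n) 0 \<le> root (2 ^ n) (gam a 0)"
      using gam_decseq[OF a] by (simp add: root_eq decseq_def)
  qed
qed

text \<open>A jump over time a + b may occur in either part. The ratio \<open>r\<close> converts
  odds over the parts into odds over the whole and tends to 1.\<close>

lemma jump_superadditive:
  assumes a: "0 < a" and b: "0 < b"
  shows "jump a x + jump b x \<le> jump (a + b) x"
proof (cases "x = 0")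
  case False
  define r where "r n = f (a / 2 ^ n) 0 * f (b / 2 ^ n) 0 / f ((a + b) / 2 ^ n) 0" for n
  have "r \<longlonglongrightarrow> 1 * 1 / 1"
    unfolding r_def using f_zero_tendsto a b by (intro tendsto_divide tendsto_mult) auto
  then have "(\<lambda>n. r n * (nu a n x + nu b n x)) \<longlonglongrightarrow> 1 * 1 / 1 * (jump a x + jump b x)"
    by (intro tendsto_mult tendsto_add nu_tendsto a b)
  moreover have "r n * (nu a n x + nu b n x) \<le> nu (a + b) n x" for n
  proof -
    have pos: "0 < f (a / 2 ^ n) 0" "0 < f (b / 2 ^ n) 0" "0 < f ((a + b) / 2 ^ n) 0"
      using f_zero_pos a b by auto
    have "r n * (nu a n x + nu b n x) = 2 ^ n * (f (a / 2 ^ n) x * f (b / 2 ^ n) 0 + f (a / 2 ^ n) 0 * f (b / 2 ^ n) x)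
        / f ((a + b) / 2 ^ n) 0"
      using pos False by (simp add: r_def nu_def divide_simps) (simp add: algebra_simps)
    also have "\<dots> \<le> 2 ^ n * f ((a + b) / 2 ^ n) x / f ((a + b) / 2 ^ n) 0"
      using f_superadditive[of "a / 2 ^ n" "b / 2 ^ n" x] a b False pos
      by (intro divide_right_mono mult_left_mono) (auto simp: add_divide_distrib)
    finally show ?thesis using False by (simp add: nu_def)
  qed
  ultimately show ?thesis
    using nu_tendsto[of "a + b" x] a b LIMSEQ_le by fastforce
next
  case True
  have "jump c x = 0" if "0 < c" for c
    using nu_tendsto[OF that, of x] True by (simp add: nu_def LIMSEQ_const_iff)
  then show ?thesis using a b by simp
qed

lemma jump_multiple:
  assumes "0 < a" "j \<ge> 1"
  shows "real j * jump a x \<le> jump (real j * a) x"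
  using assms(2)
proof (induction j rule: dec_induct)
  case (step j)
  then show ?case
    using jump_superadditive[of "real j * a" a x] assms(1) by (simp add: distrib_right add.commute)
qed simp

text \<open>Fill time b with d pieces of length a / 2^q, whose intensity is known exactly, and drop
  the rest. Exchanging a and b then gives the reverse inequality.\<close>

lemma jump_ratio_le:
  assumes a: "0 < a" and b: "0 < b"
  shows "b / a * jump a x \<le> jump b x"
proof (rule field_le_epsilon)
  fix e :: real assume e: "0 < e"
  show "b / a * jump a x \<le> jump b x + e"
  proof -
    obtain q where q: "jump a x / e < 2 ^ q" "2 * a / b < 2 ^ q"
    proof -
      obtain q1 q2 where "jump a x / e < 2 ^ q1" "2 * a / b < 2 ^ q2"
        using real_arch_pow[of 2] by fastforce
      moreover have "(2::real) ^ q1 \<le> 2 ^ max q1 q2" "(2::real) ^ q2 \<le> 2 ^ max q1 q2"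
        by (auto intro!: power_increasing)
      ultimately show ?thesis using that[of "max q1 q2"] by linarith
    qed
    \<comment> \<open>The largest integer strictly below b / a * 2^q: superadditivity is applied to
      a remainder of positive length.\<close>
    define d where "d = nat (\<lceil>b / a * 2 ^ q\<rceil> - 1)"
    have big: "2 < b / a * 2 ^ q" using q(2) a b by (simp add: field_simps)
    have p: "real d < b / a * 2 ^ q" "b / a * 2 ^ q \<le> real d + 1" "d \<ge> 1"
      using big unfolding d_def by linarith+
    have "real d * (jump a x / 2 ^ q) \<le> jump (real d * (a / 2 ^ q)) x"
      using jump_multiple[of "a / 2 ^ q" d x] jump_dyadic[OF a, of q x] p a by simp
    also have "\<dots> \<le> jump b x"
    proof -
      have "real d * (a / 2 ^ q) < b" using p(1) a by (simp add: field_simps)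
      moreover have "0 < real d * (a / 2 ^ q)" using a p by simp
      ultimately show ?thesis
        using jump_superadditive[of "real d * (a / 2 ^ q)" "b - real d * (a / 2 ^ q)" x]
          jump_nonneg[of "b - real d * (a / 2 ^ q)" x] by simp
    qed
    finally have 1: "real d * (jump a x / 2 ^ q) \<le> jump b x" .
    have "b / a * jump a x = b / a * 2 ^ q * (jump a x / 2 ^ q)" by simp
    also have "\<dots> \<le> (real d + 1) * (jump a x / 2 ^ q)"
      using p(2) jump_nonneg[OF a] by (intro mult_right_mono) auto
    also have "\<dots> = real d * (jump a x / 2 ^ q) + jump a x / 2 ^ q"
      by (simp add: algebra_simps add_divide_distrib)
    finally have "b / a * jump a x \<le> real d * (jump a x / 2 ^ q) + jump a x / 2 ^ q" .
    moreover have "jump a x / 2 ^ q \<le> e" using q(1) e by (simp add: field_simps)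
    ultimately show ?thesis using 1 by linarith
  qed
qed

lemma jump_linear:
  assumes "0 < a"
  shows "jump a x = a * jump 1 x"
  using jump_ratio_le[OF assms, of 1 x] jump_ratio_le[OF _ assms, of 1 x] assms
  by (simp add: field_simps)

theorem compound_poisson:
  assumes a: "0 < a"
  shows "wt (F a) x = nsum (\<lambda>m. ennreal (gam_lim a * a ^ m / fact m) * wt (jump_weights 1 ^ m) x)"
proof -
  have "jump_weights a = const_weights (ennreal a) * jump_weights 1"
    using a by (intro weights_eqI) (simp add: jump_weights_def jump_linear[OF a] ennreal_mult jump_nonneg)
  then have "wt (jump_weights a ^ m) x = ennreal (a ^ m) * wt (jump_weights 1 ^ m) x" for m
    using a by (simp add: power_mult_distrib const_weights_power ennreal_power)
  then show ?thesis
    unfolding exponential_series[OF a] using gam_lim_pos[OF a] a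
    by (simp add: mult.assoc[symmetric] ennreal_mult[symmetric])
qed

end

section \<open>Moments of the bridge\<close>

lemma has_sum_of_nsum:
  fixes h :: "'a \<Rightarrow> real"
  assumes "\<And>x. 0 \<le> h x" "0 \<le> r" "nsum (\<lambda>x. ennreal (h x)) = ennreal r"
  shows "(h has_sum r) UNIV"
proof -
  have "has_bochner_integral (count_space UNIV) h r"
    using assms by (intro has_bochner_integral_nn_integral) auto
  then have abs: "Infinite_Set_Sum.abs_summable_on h UNIV" and r: "infsetsum h UNIV = r"
    by (auto simp: abs_summable_on_def infsetsum_def has_bochner_integral_iff set_integrable_def)
  have "h summable_on UNIV"
    by (rule abs_summable_summable[OF abs_summable_equivalent[THEN iffD2, OF abs]])
  then show ?thesis
    using infsetsum_infsum[OF abs] r by (simp add: has_sum_infsum)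
qed

text \<open>Fubini for signed terms: summability of the inner absolute sums \<open>G\<close> yields
  joint summability.\<close>

lemma has_sum_iterated:
  fixes f :: "'a \<times> 'b \<Rightarrow> real"
  assumes f: "\<And>a. ((\<lambda>b. f (a, b)) has_sum g a) UNIV"
    and abs: "\<And>a. ((\<lambda>b. \<bar>f (a, b)\<bar>) has_sum G a) UNIV"
    and G: "G summable_on UNIV"
  obtains S where "(f has_sum S) UNIV" "(g has_sum S) UNIV"
proof -
  have "(\<lambda>z. norm (f z)) summable_on (UNIV \<times> UNIV)"
    unfolding Infinite_Sum.abs_summable_on_Sigma_iff
  proof (intro conjI ballI)
    fix a
    show "(\<lambda>b. norm (f (a, b))) summable_on UNIV"
      using abs[of a] by (auto simp: summable_on_def)
  next
    have "infsum (\<lambda>b. norm (f (a, b))) UNIV = G a" for a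
      using abs[of a] by (simp add: infsumI)
    moreover have "0 \<le> G a" for a
      using abs[of a] by (rule has_sum_nonneg) simp
    ultimately show "(\<lambda>a. norm (infsum (\<lambda>b. norm (f (a, b))) UNIV)) summable_on UNIV"
      using G by simp
  qed
  then have "f summable_on UNIV" by (simp add: abs_summable_summable)
  then obtain S where S: "(f has_sum S) UNIV" by (auto simp: summable_on_def)
  then have "(g has_sum S) UNIV"
    using has_sum_SigmaD[where f = f and A = UNIV and B = "\<lambda>_. UNIV" and g = g] f by simp
  with S show ?thesis by (rule that)
qed

lemma summable_on_section:
  fixes f :: "'a \<times> 'b \<Rightarrow> real"
  assumes "f summable_on UNIV"
  shows "(\<lambda>b. f (a, b)) summable_on UNIV"
proof -
  have "(\<lambda>z. norm (f z)) summable_on (UNIV \<times> UNIV)"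
    using summable_on_iff_abs_summable_on_real[THEN iffD1, OF assms] by simp
  from Infinite_Sum.abs_summable_on_Sigma_iff[THEN iffD1, OF this]
  have "(\<lambda>b. norm (f (a, b))) summable_on UNIV" by blast
  then show ?thesis by (rule abs_summable_summable)
qed

lemma has_sum_swap_iff:
  "((\<lambda>(b, a). f (a, b)) has_sum S) UNIV \<longleftrightarrow> (f has_sum S) UNIV"
proof -
  have "bij_betw prod.swap UNIV UNIV" by simp
  from has_sum_reindex_bij_betw[OF this, of f S] show ?thesis
    by (simp add: prod.swap_def case_prod_beta')
qed

lemma has_sum_diagonal:
  fixes h :: "nat \<Rightarrow> nat \<Rightarrow> real"
  assumes "((\<lambda>(i, j). h i j) has_sum S) UNIV"
  shows "((\<lambda>n. \<Sum>i\<le>n. h i (n - i)) has_sum S) UNIV"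
proof -
  have bij: "bij_betw (\<lambda>(n, i). (i, n - i)) (SIGMA n:UNIV. {..n::nat}) UNIV"
    by (rule bij_betw_byWitness[where f' = "\<lambda>(i, j). (i + j, i)"]) auto
  have "((\<lambda>(n, i). h i (n - i)) has_sum S) (SIGMA n:UNIV. {..n})"
    using has_sum_reindex_bij_betw[OF bij, of "\<lambda>(i, j). h i j" S] assms by (simp add: case_prod_beta')
  from has_sum_SigmaD[OF this, where g = "\<lambda>n. \<Sum>i\<le>n. h i (n - i)"] show ?thesis by simp
qed

lemma has_sum_product_real:
  fixes f :: "'a \<Rightarrow> real" and g :: "'b \<Rightarrow> real"
  assumes "\<And>a. 0 \<le> f a" "\<And>b. 0 \<le> g b" "(f has_sum s) UNIV" "(g has_sum t) UNIV"
  shows "((\<lambda>(a, b). f a * g b) has_sum s * t) UNIV"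
proof -
  have "((\<lambda>b. f a * g b) has_sum f a * t) UNIV" for a
    using assms by (intro has_sum_cmult_right)
  moreover have "(\<lambda>a. f a * t) summable_on UNIV"
    using assms by (auto simp: summable_on_def intro: has_sum_cmult_left)
  ultimately obtain S where S: "((\<lambda>(a, b). f a * g b) has_sum S) UNIV" "((\<lambda>a. f a * t) has_sum S) UNIV"
    using has_sum_iterated[of "\<lambda>(a, b). f a * g b" "\<lambda>a. f a * t" "\<lambda>a. f a * t"] assms(1,2)
    by (auto simp: abs_mult)
  have "S = s * t" using S(2) has_sum_cmult_left[OF assms(3)] by (rule has_sum_unique)
  with S show ?thesis by simp
qed

text \<open>By exchangeability, each of the \<open>i + j\<close> steps contributes equally to \<open>\<phi> k\<close>.\<close>

lemma pinned_moment:
  fixes v :: "nat \<Rightarrow> 'g::ab_group_add \<Rightarrow> real" and \<phi> :: "'g \<Rightarrow> real"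
  assumes nonneg: "\<And>i x. 0 \<le> v i x"
    and v0: "\<And>x. v 0 x = (if x = 0 then 1 else 0)"
    and conv: "\<And>i j k. ((\<lambda>x. v i x * v j (k - x)) has_sum v (i + j) k) UNIV"
    and add: "\<And>x y. \<phi> (x + y) = \<phi> x + \<phi> y"
    and summable: "\<And>i j. i \<ge> 1 \<Longrightarrow> j \<ge> 1 \<Longrightarrow> (\<lambda>x. \<phi> x * v i x * v j (k - x)) summable_on UNIV"
  shows "((\<lambda>x. \<phi> x * v i x * v j (k - x)) has_sum real i / real (i + j) * \<phi> k * v (i + j) k) UNIV"
proof -
  have \<phi>0: "\<phi> 0 = 0" using add[of 0 0] by simp
  have last: "((\<lambda>x. \<phi> x * v i x * v 0 (k - x)) has_sum \<phi> k * v i k) UNIV" for i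
  proof -
    have "((\<lambda>x. \<phi> x * v i x * v 0 (k - x)) has_sum (\<Sum>x\<in>{k}. \<phi> x * v i x * v 0 (k - x))) {k}"
      by (rule has_sum_finite) simp
    also have "?this \<longleftrightarrow> ((\<lambda>x. \<phi> x * v i x * v 0 (k - x)) has_sum (\<Sum>x\<in>{k}. \<phi> x * v i x * v 0 (k - x))) UNIV"
      by (rule has_sum_cong_neutral) (auto simp: v0)
    finally show ?thesis by (simp add: v0)
  qed
  \<comment> \<open>The moment of the first i of i + j steps with sum k; it will turn out to be i
    times the moment of a single step.\<close>
  define s where "s i j = infsum (\<lambda>x. \<phi> x * v i x * v j (k - x)) UNIV" for i j
  have s: "((\<lambda>x. \<phi> x * v i x * v j (k - x)) has_sum s i j) UNIV" if "i \<ge> 1" for i j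
  proof (cases "j = 0")
    case True
    then show ?thesis using last[of i] by (simp add: s_def infsumI)
  next
    case False
    then show ?thesis unfolding s_def by (intro has_sum_infsum summable that) simp
  qed
  have part: "((\<lambda>(y, x). \<phi> y * v i y * (v j x * v j' (k - y - x))) has_sum s i (j + j')) UNIV"
    if "i \<ge> 1" "j + j' \<ge> 1" for i j j'
  proof -
    have "((\<lambda>x. \<phi> y * v i y * (v j x * v j' (k - y - x))) has_sum \<phi> y * v i y * v (j + j') (k - y)) UNIV" for y
      by (intro has_sum_cmult_right conv)
    moreover have "((\<lambda>x. \<bar>\<phi> y * v i y * (v j x * v j' (k - y - x))\<bar>) has_sum \<bar>\<phi> y * v i y * v (j + j') (k - y)\<bar>) UNIV" for y
      unfolding abs_mult using nonneg by (auto intro!: has_sum_cmult_right conv)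
    moreover have "(\<lambda>y. \<bar>\<phi> y * v i y * v (j + j') (k - y)\<bar>) summable_on UNIV"
      using has_sum_imp_summable[OF s[OF that(1)]]
      unfolding real_norm_def[symmetric] by (rule summable_on_iff_abs_summable_on_real[THEN iffD1])
    ultimately obtain S where S: "((\<lambda>(y, x). \<phi> y * v i y * (v j x * v j' (k - y - x))) has_sum S) UNIV"
      "((\<lambda>y. \<phi> y * v i y * v (j + j') (k - y)) has_sum S) UNIV"
      using has_sum_iterated[of "\<lambda>(y, x). \<phi> y * v i y * (v j x * v j' (k - y - x))"
        "\<lambda>y. \<phi> y * v i y * v (j + j') (k - y)" "\<lambda>y. \<bar>\<phi> y * v i y * v (j + j') (k - y)\<bar>"]
      unfolding prod.case by blast
    have "S = s i (j + j')" using S(2) s[OF that(1)] by (rule has_sum_unique)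
    with S show ?thesis by simp
  qed
  \<comment> \<open>Split i + 1 steps into one step y and i steps with sum z. Additivity of \<phi>
    separates the two, and in the second part the order of y and z is exchanged.\<close>
  have step: "s (Suc i) j = s 1 (i + j) + s i (Suc j)" if i: "i \<ge> 1" for i j
  proof -
    let ?w = "\<lambda>y z. v 1 y * v i z * v j (k - y - z)"
    have 1: "((\<lambda>(y, z). \<phi> y * ?w y z) has_sum s 1 (i + j)) UNIV"
      using part[of 1 i j] i by (simp add: mult.assoc)
    have "((\<lambda>(z, y). \<phi> z * v i z * (v 1 y * v j (k - z - y))) has_sum s i (Suc j)) UNIV"
      using part[of i 1 j] i by simp
    then have "((\<lambda>(y, z). \<phi> z * v i z * (v 1 y * v j (k - z - y))) has_sum s i (Suc j)) UNIV"
      using has_sum_swap_iff[of "\<lambda>(z, y). \<phi> z * v i z * (v 1 y * v j (k - z - y))"] by simp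
    also have "(\<lambda>(y, z). \<phi> z * v i z * (v 1 y * v j (k - z - y))) = (\<lambda>(y, z). \<phi> z * ?w y z)"
      by (auto simp: fun_eq_iff ac_simps algebra_simps)
    finally have 2: "((\<lambda>(y, z). \<phi> z * ?w y z) has_sum s i (Suc j)) UNIV" .
    have "((\<lambda>(y, z). \<phi> (y + z) * ?w y z) has_sum (s 1 (i + j) + s i (Suc j))) UNIV"
      using has_sum_add[OF 1 2] by (simp add: case_prod_beta' add distrib_right)
    moreover have bij: "bij_betw (\<lambda>(x, y). (y, x - y)) UNIV (UNIV :: ('g \<times> 'g) set)"
      by (rule bij_betw_byWitness[where f' = "\<lambda>(y, z). (y + z, y)"]) auto
    ultimately have "((\<lambda>(x, y). \<phi> x * v j (k - x) * (v 1 y * v i (x - y))) has_sum (s 1 (i + j) + s i (Suc j))) (UNIV \<times> UNIV)"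
      using has_sum_reindex_bij_betw[OF bij, of "\<lambda>(y, z). \<phi> (y + z) * ?w y z"]
      by (simp add: case_prod_beta' algebra_simps)
    moreover have "((\<lambda>y. \<phi> x * v j (k - x) * (v 1 y * v i (x - y))) has_sum \<phi> x * v j (k - x) * v (Suc i) x) UNIV" for x
      using conv[of 1 i x] by (intro has_sum_cmult_right) simp
    ultimately have "((\<lambda>x. \<phi> x * v j (k - x) * v (Suc i) x) has_sum (s 1 (i + j) + s i (Suc j))) UNIV"
      using has_sum_SigmaD[where f = "\<lambda>(x, y). \<phi> x * v j (k - x) * (v 1 y * v i (x - y))" and A = UNIV and B = "\<lambda>_. UNIV"] by simp
    moreover have "((\<lambda>x. \<phi> x * v j (k - x) * v (Suc i) x) has_sum s (Suc i) j) UNIV"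
      using s[of "Suc i" j] by (simp add: ac_simps)
    ultimately show ?thesis using has_sum_unique by blast
  qed
  have lin: "s i j = real i * s 1 (i + j - 1)" if "i \<ge> 1" for i j
    using that
  proof (induction i arbitrary: j rule: dec_induct)
    case (step i)
    then show ?case using \<open>\<And>i j. i \<ge> 1 \<Longrightarrow> s (Suc i) j = s 1 (i + j) + s i (Suc j)\<close>[of i j]
      by (simp add: algebra_simps)
  qed simp
  show ?thesis
  proof (cases "i = 0")
    case True
    \<comment> \<open>For i = 0 only x = 0 carries weight, where \<phi> is 0; if j = 0 as well, the
      claimed factor is 0 / 0 = 0.\<close>
    then have "(\<lambda>x. \<phi> x * v i x * v j (k - x)) = (\<lambda>_. 0)" by (auto simp: v0 \<phi>0)
    with True show ?thesis by simp
  next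
    case False
    \<comment> \<open>All i + j steps together have displacement k, which determines the moment of
      one step.\<close>
    have "s (i + j) 0 = \<phi> k * v (i + j) k"
      using last[of "i + j"] by (simp add: s_def infsumI)
    then have "real (i + j) * s 1 (i + j - 1) = \<phi> k * v (i + j) k"
      using lin[of "i + j" 0] False by simp
    then have "s i j = real i / real (i + j) * \<phi> k * v (i + j) k"
      using lin[of i j] False by (simp add: field_simps)
    then show ?thesis using s[of i j] False by simp
  qed
qed

lemma sum_exp_coefficients:
  fixes a b :: real
  shows "(\<Sum>i\<le>n. a ^ i / fact i * (b ^ (n - i) / fact (n - i))) = (a + b) ^ n / fact n"
proof -
  have "(a + b) ^ n / fact n = (\<Sum>i\<le>n. real (n choose i) * a ^ i * b ^ (n - i) / fact n)"
    by (simp only: binomial_ring sum_divide_distrib)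
  also have "\<dots> = (\<Sum>i\<le>n. a ^ i / fact i * (b ^ (n - i) / fact (n - i)))"
    by (intro sum.cong) (auto simp: binomial_fact field_simps)
  finally show ?thesis ..
qed

text \<open>For positive a and b this is the mean n a / (a + b) of a binomial law, divided by n and
  carrying the weight (a + b)^n / n!.\<close>

lemma sum_exp_coefficients_weighted:
  fixes a b :: real
  assumes "a + b \<noteq> 0" "n \<ge> 1"
  shows "(\<Sum>i\<le>n. a ^ i / fact i * (b ^ (n - i) / fact (n - i)) * (real i / real n))
    = a / (a + b) * ((a + b) ^ n / fact n)"
proof -
  obtain m where n: "n = Suc m" using assms(2) by (cases n) auto
  have "(\<Sum>i\<le>n. a ^ i / fact i * (b ^ (n - i) / fact (n - i)) * (real i / real n))
      = (\<Sum>i\<le>m. a / real n * (a ^ i / fact i * (b ^ (m - i) / fact (m - i))))"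
    unfolding n by (subst sum.atMost_Suc_shift)
      (auto intro!: sum.cong simp: divide_simps simp del: of_nat_Suc)
  also have "\<dots> = a / real n * ((a + b) ^ m / fact m)"
    by (simp only: sum_distrib_left[symmetric] sum_exp_coefficients)
  also have "\<dots> = a / (a + b) * ((a + b) ^ n / fact n)"
  proof -
    have "(a + b) ^ n / fact n = (a + b) * ((a + b) ^ m / fact m) / real n"
      by (simp add: n)
    then show ?thesis using assms(1) by simp
  qed
  finally show ?thesis .
qed

context nonzero_lattice_semigroup
begin

definition v :: "nat \<Rightarrow> int ^ 'a \<Rightarrow> real"
  where "v m x = enn2real (wt (jump_weights 1 ^ m) x)"

text \<open>With a positive coefficient this is one term of the series for \<open>F 1\<close>, from
  which it inherits finiteness.\<close>

lemma wt_jump_power: "wt (jump_weights 1 ^ m) x = ennreal (v m x)"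
proof -
  have "ennreal (gam_lim 1 * 1 ^ m / fact m) * wt (jump_weights 1 ^ m) x \<le> wt (F 1) x"
    unfolding compound_poisson[OF zero_less_one] by (rule nsum_ge_point)
  also have "\<dots> < \<top>" by (rule F_finite) simp
  finally have "wt (jump_weights 1 ^ m) x < \<top>"
    using gam_lim_pos[of 1] by (auto simp: ennreal_mult_less_top)
  then show ?thesis by (simp add: v_def)
qed

lemma v_nonneg: "0 \<le> v m x"
  by (simp add: v_def)

lemma v_convolution: "((\<lambda>x. v i x * v j (k - x)) has_sum v (i + j) k) UNIV"
proof (rule has_sum_of_nsum)
  show "nsum (\<lambda>x. ennreal (v i x * v j (k - x))) = ennreal (v (i + j) k)"
    by (simp add: wt_jump_power[symmetric] power_add wt_mult ennreal_mult v_nonneg)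
qed (auto simp: v_nonneg)

lemma f_has_sum:
  assumes "0 < a"
  shows "((\<lambda>m. gam_lim a * a ^ m / fact m * v m x) has_sum f a x) UNIV"
proof (rule has_sum_of_nsum)
  have "nsum (\<lambda>m. ennreal (gam_lim a * a ^ m / fact m * v m x))
      = nsum (\<lambda>m. ennreal (gam_lim a * a ^ m / fact m) * ennreal (v m x))"
    using assms gam_lim_pos[OF assms] by (intro nn_integral_cong ennreal_mult) (auto simp: v_nonneg)
  then show "nsum (\<lambda>m. ennreal (gam_lim a * a ^ m / fact m * v m x)) = ennreal (f a x)"
    using compound_poisson[OF assms, of x] by (simp only: wt_F[OF assms] wt_jump_power)
qed (use assms gam_lim_pos[OF assms] in \<open>auto simp: v_nonneg f_nonneg\<close>)

text \<open>Expansion by the numbers i and j of jumps before and after time a. The coefficients are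
  nonnegative and \<psi> depends on x only, so absolute summability over x extends to all triples.
  It serves both \<psi> = \<phi> and \<psi> = 1.\<close>

lemma pinned_sum_expansion:
  assumes a: "0 < a" and b: "0 < b"
    and summable: "(\<lambda>x. \<psi> x * (f a x * f b (k - x))) summable_on UNIV"
  obtains S where "((\<lambda>x. \<psi> x * (f a x * f b (k - x))) has_sum S) UNIV"
    "((\<lambda>((i, j), x). \<psi> x * ((gam_lim a * a ^ i / fact i * v i x) *
      (gam_lim b * b ^ j / fact j * v j (k - x)))) has_sum S) UNIV"
proof -
  let ?c = "\<lambda>i j x. (gam_lim a * a ^ i / fact i * v i x) * (gam_lim b * b ^ j / fact j * v j (k - x))"
  have nonneg: "0 \<le> ?c i j x" for i j x
    using a b gam_lim_pos[OF a] gam_lim_pos[OF b] v_nonneg by simp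
  have inner: "((\<lambda>(i, j). ?c i j x) has_sum f a x * f b (k - x)) UNIV" for x
    using a b gam_lim_pos[OF a] gam_lim_pos[OF b]
    by (intro has_sum_product_real f_has_sum) (auto simp: v_nonneg)
  have "((\<lambda>ij. \<psi> x * (\<lambda>(i, j). ?c i j x) ij) has_sum \<psi> x * (f a x * f b (k - x))) UNIV" for x
    by (intro has_sum_cmult_right inner)
  moreover have "((\<lambda>ij. \<bar>\<psi> x * (\<lambda>(i, j). ?c i j x) ij\<bar>) has_sum \<bar>\<psi> x * (f a x * f b (k - x))\<bar>) UNIV" for x
  proof -
    have "\<bar>\<psi> x * (\<lambda>(i, j). ?c i j x) ij\<bar> = \<bar>\<psi> x\<bar> * (\<lambda>(i, j). ?c i j x) ij" for ij
      using nonneg[of "fst ij" x "snd ij"] by (simp only: case_prod_beta abs_mult[of "\<psi> x"] abs_of_nonneg)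
    moreover have "\<bar>\<psi> x * (f a x * f b (k - x))\<bar> = \<bar>\<psi> x\<bar> * (f a x * f b (k - x))"
      by (simp add: abs_mult f_nonneg)
    ultimately show ?thesis by (simp only: has_sum_cmult_right[OF inner])
  qed
  moreover have "(\<lambda>x. \<bar>\<psi> x * (f a x * f b (k - x))\<bar>) summable_on UNIV"
    using summable_on_iff_abs_summable_on_real[THEN iffD1, OF summable] unfolding real_norm_def .
  ultimately obtain S where S: "((\<lambda>(x, ij). \<psi> x * (\<lambda>(i, j). ?c i j x) ij) has_sum S) UNIV"
    "((\<lambda>x. \<psi> x * (f a x * f b (k - x))) has_sum S) UNIV"
    using has_sum_iterated[of "\<lambda>(x, ij). \<psi> x * (\<lambda>(i, j). ?c i j x) ij"
        "\<lambda>x. \<psi> x * (f a x * f b (k - x))" "\<lambda>x. \<bar>\<psi> x * (f a x * f b (k - x))\<bar>"]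
    unfolding prod.case by blast
  show ?thesis
  proof (rule that[OF S(2)])
    have "((\<lambda>(ij, x). \<psi> x * (\<lambda>(i, j). ?c i j x) ij) has_sum S) UNIV"
      using has_sum_swap_iff[of "\<lambda>(x, ij). \<psi> x * (\<lambda>(i, j). ?c i j x) ij" S] S(1) by (simp only: prod.case)
    then show "((\<lambda>((i, j), x). \<psi> x * ?c i j x) has_sum S) UNIV"
      by (simp only: case_prod_beta' fst_conv snd_conv)
  qed
qed

lemma f_convolution:
  assumes "0 < a" "0 < b"
  shows "((\<lambda>x. f a x * f b (k - x)) has_sum f (a + b) k) UNIV"
proof (rule has_sum_of_nsum)
  show "nsum (\<lambda>x. ennreal (f a x * f b (k - x))) = ennreal (f (a + b) k)"
    using assms by (simp add: wt_F[symmetric] F_add[symmetric] wt_mult ennreal_mult f_nonneg)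
qed (auto simp: f_nonneg)

text \<open>If i of n jumps occur before time a, the conditional mean is i / n * \<phi> k by
  exchangeability; given n, the number i is binomial with parameter a / (a + b). The factor a / (a +
  b) * \<phi> k is therefore the same for every n.\<close>

theorem bridge_moment:
  assumes a: "0 < a" and b: "0 < b"
    and add: "\<And>x y. \<phi> (x + y) = \<phi> x + \<phi> y"
    and summable: "(\<lambda>x. \<phi> x * (f a x * f b (k - x))) summable_on UNIV"
  shows "((\<lambda>x. \<phi> x * (f a x * f b (k - x))) has_sum a / (a + b) * \<phi> k * f (a + b) k) UNIV"
proof -
  define p q where "p i = gam_lim a * a ^ i / fact i" and "q j = gam_lim b * b ^ j / fact j" for i j
  have pq: "0 < p i" "0 < q j" for i j
    using a b gam_lim_pos[OF a] gam_lim_pos[OF b] by (auto simp: p_def q_def)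
  have \<phi>0: "\<phi> 0 = 0" using add[of 0 0] by simp
  obtain S where S: "((\<lambda>x. \<phi> x * (f a x * f b (k - x))) has_sum S) UNIV"
    and S': "((\<lambda>((i, j), x). \<phi> x * ((p i * v i x) * (q j * v j (k - x)))) has_sum S) UNIV"
    using pinned_sum_expansion[OF a b summable] unfolding p_def q_def by blast
  have v0: "v 0 x = (if x = 0 then 1 else 0)" for x
    by (simp add: v_def wt_one)
  have moment: "((\<lambda>x. \<phi> x * v i x * v j (k - x)) has_sum real i / real (i + j) * \<phi> k * v (i + j) k) UNIV" for i j
  proof (rule pinned_moment[where v = v and \<phi> = \<phi>, OF v_nonneg v0 v_convolution add])
    fix i j
    have "(\<lambda>((i, j), x). \<phi> x * ((p i * v i x) * (q j * v j (k - x)))) summable_on UNIV"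
      using S' by (auto simp: summable_on_def)
    from summable_on_section[OF this, of "(i, j)"]
    have "(\<lambda>x. \<phi> x * ((p i * v i x) * (q j * v j (k - x)))) summable_on UNIV"
      by simp
    from summable_on_cmult_right[OF this, of "1 / (p i * q j)"]
    show "(\<lambda>x. \<phi> x * v i x * v j (k - x)) summable_on UNIV"
      using pq(1)[of i] pq(2)[of j] by (simp add: field_simps)
  qed
  have "((\<lambda>x. \<phi> x * ((p i * v i x) * (q j * v j (k - x)))) has_sum
      p i * q j * (real i / real (i + j) * \<phi> k * v (i + j) k)) UNIV" for i j
    using has_sum_cmult_right[OF moment[of i j], of "p i * q j"] by (simp add: mult_ac)
  then have "((\<lambda>(i, j). p i * q j * (real i / real (i + j) * \<phi> k * v (i + j) k)) has_sum S) UNIV"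
    using has_sum_SigmaD[where f = "\<lambda>((i, j), x). \<phi> x * ((p i * v i x) * (q j * v j (k - x)))" and A = UNIV and B = "\<lambda>_. UNIV"] S'
    by (simp add: case_prod_beta)
  from has_sum_diagonal[OF this]
  have "((\<lambda>n. \<Sum>i\<le>n. p i * q (n - i) * (real i / real n * \<phi> k * v n k)) has_sum S) UNIV"
    by simp
  also have "(\<lambda>n. \<Sum>i\<le>n. p i * q (n - i) * (real i / real n * \<phi> k * v n k))
      = (\<lambda>n. a / (a + b) * \<phi> k * (gam_lim a * gam_lim b * ((a + b) ^ n / fact n) * v n k))"
  proof
    fix n
    show "(\<Sum>i\<le>n. p i * q (n - i) * (real i / real n * \<phi> k * v n k))
      = a / (a + b) * \<phi> k * (gam_lim a * gam_lim b * ((a + b) ^ n / fact n) * v n k)"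
    proof (cases "n = 0")
      case True
      \<comment> \<open>Without jumps only k = 0 carries weight, and there \<phi> vanishes.\<close>
      then show ?thesis using \<phi>0 by (simp add: v0)
    next
      case False
      have "(\<Sum>i\<le>n. p i * q (n - i) * (real i / real n * \<phi> k * v n k))
        = gam_lim a * gam_lim b * \<phi> k * v n k *
          (\<Sum>i\<le>n. a ^ i / fact i * (b ^ (n - i) / fact (n - i)) * (real i / real n))"
        unfolding sum_distrib_left by (intro sum.cong) (auto simp: p_def q_def)
      then show ?thesis
        using sum_exp_coefficients_weighted[of a b n] a b False by simp
    qed
  qed
  finally have moment_series: "((\<lambda>n. a / (a + b) * \<phi> k * (gam_lim a * gam_lim b * ((a + b) ^ n / fact n) * v n k)) has_sum S) UNIV" .
  \<comment> \<open>The expansion with \<psi> = 1 sums to \<open>f (a + b) k\<close>; its series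
    differs from the moment series only by the constant factor, which evaluates S.\<close>
  obtain S0 where S0: "((\<lambda>x. 1 * (f a x * f b (k - x))) has_sum S0) UNIV"
    and S0': "((\<lambda>((i, j), x). 1 * ((p i * v i x) * (q j * v j (k - x)))) has_sum S0) UNIV"
  proof -
    have "(\<lambda>x. 1 * (f a x * f b (k - x))) summable_on UNIV"
      using f_convolution[OF a b, of k] by (auto simp: summable_on_def)
    from pinned_sum_expansion[OF a b this] that show ?thesis unfolding p_def q_def by blast
  qed
  have "S0 = f (a + b) k"
    using S0 f_convolution[OF a b, of k] has_sum_unique by fastforce
  have "((\<lambda>x. 1 * ((p i * v i x) * (q j * v j (k - x)))) has_sum p i * q j * v (i + j) k) UNIV" for i j
    using has_sum_cmult_right[OF v_convolution[of i j k], of "p i * q j"] by (simp add: mult_ac)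
  then have "((\<lambda>(i, j). p i * q j * v (i + j) k) has_sum S0) UNIV"
    using has_sum_SigmaD[where f = "\<lambda>((i, j), x). 1 * ((p i * v i x) * (q j * v j (k - x)))" and A = UNIV and B = "\<lambda>_. UNIV"] S0'
    by (simp add: case_prod_beta)
  from has_sum_diagonal[OF this]
  have "((\<lambda>n. \<Sum>i\<le>n. p i * q (n - i) * v n k) has_sum S0) UNIV" by simp
  also have "(\<lambda>n. \<Sum>i\<le>n. p i * q (n - i) * v n k)
      = (\<lambda>n. gam_lim a * gam_lim b * ((a + b) ^ n / fact n) * v n k)"
  proof
    fix n
    have "(\<Sum>i\<le>n. p i * q (n - i) * v n k)
      = gam_lim a * gam_lim b * v n k * (\<Sum>i\<le>n. a ^ i / fact i * (b ^ (n - i) / fact (n - i)))"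
      unfolding sum_distrib_left by (intro sum.cong) (auto simp: p_def q_def)
    then show "(\<Sum>i\<le>n. p i * q (n - i) * v n k) = gam_lim a * gam_lim b * ((a + b) ^ n / fact n) * v n k"
      by (simp only: sum_exp_coefficients mult_ac)
  qed
  finally have "((\<lambda>n. gam_lim a * gam_lim b * ((a + b) ^ n / fact n) * v n k) has_sum f (a + b) k) UNIV"
    using \<open>S0 = f (a + b) k\<close> by simp
  then have "S = a / (a + b) * \<phi> k * f (a + b) k"
    using has_sum_unique[OF moment_series] has_sum_cmult_right by blast
  with S show ?thesis by simp
qed

end

section \<open>From measures on the lattice to weight functions and back\<close>

lemma lattice_semigroup_mass:
  fixes \<mu> :: "real \<Rightarrow> (int ^ 'n) measure"
  assumes \<mu>: "convolution_semigroup \<mu>"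
  shows "lattice_semigroup (\<lambda>a. Weights (\<lambda>k. ennreal (mass \<mu> a k)))"
proof
  fix a b :: real assume a: "0 < a" and b: "0 < b"
  have sets: "sets (\<mu> a) = UNIV" "sets (\<mu> b) = UNIV"
    using \<mu> a b by (auto simp: convolution_semigroup_def)
  have mass: "emeasure (\<mu> l) {k} = ennreal (mass \<mu> l k)" if "0 < l" for l k
    using \<mu> that by (simp add: convolution_semigroup_def mass_def emeasure_eq_ennreal_measure less_top[symmetric])
  \<comment> \<open>Countably many singletons of finite mass exhaust the lattice; this gives access
    to sections in the product measure.\<close>
  interpret \<mu>b: sigma_finite_measure "\<mu> b"
  proof
    have "space (\<mu> b) = UNIV" using sets(2) by (metis sets.top sets.sets_into_space UNIV_I top.extremum_uniqueI)
    then show "\<exists>A. countable A \<and> A \<subseteq> sets (\<mu> b) \<and> \<Union>A = space (\<mu> b) \<and> (\<forall>a\<in>A. emeasure (\<mu> b) a \<noteq> \<infinity>)"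
      using sets(2) mass[OF b] by (intro exI[of _ "range (\<lambda>k. {k})"]) auto
  qed
  have sets_pair: "sets (\<mu> a \<Otimes>\<^sub>M \<mu> b) = UNIV"
  proof -
    have "sets (\<mu> a \<Otimes>\<^sub>M \<mu> b) = sets (count_space (UNIV :: (int ^ 'n) set) \<Otimes>\<^sub>M count_space (UNIV :: (int ^ 'n) set))"
      using sets by (intro sets_pair_measure_cong) auto
    then show ?thesis unfolding pair_measure_countable[OF countableI_type countableI_type] by simp
  qed
  show "Weights (\<lambda>k. ennreal (mass \<mu> a k)) * Weights (\<lambda>k. ennreal (mass \<mu> b k)) =
      Weights (\<lambda>k. ennreal (mass \<mu> (a + b) k))"
  proof (rule weights_eqI)
    fix k
    have "ennreal (mass \<mu> (a + b) k) = emeasure (lattice_convolution (\<mu> a) (\<mu> b)) {k}"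
      using \<mu> a b mass[of "a + b" k] by (simp add: convolution_semigroup_def)
    also have "\<dots> = emeasure (\<mu> a \<Otimes>\<^sub>M \<mu> b) ((\<lambda>(x, y). x + y) -` {k} \<inter> space (\<mu> a \<Otimes>\<^sub>M \<mu> b))"
      unfolding lattice_convolution_def
      by (rule emeasure_distr) (auto simp: measurable_def sets_pair)
    also have "\<dots> = (\<integral>\<^sup>+x. emeasure (\<mu> b) (Pair x -` ((\<lambda>(x, y). x + y) -` {k} \<inter> space (\<mu> a \<Otimes>\<^sub>M \<mu> b))) \<partial>\<mu> a)"
      by (rule \<mu>b.emeasure_pair_measure_alt) (simp add: sets_pair)
    also have "\<dots> = (\<integral>\<^sup>+x. ennreal (mass \<mu> b (k - x)) \<partial>\<mu> a)"
    proof (rule nn_integral_cong)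
      fix x
      have "space (\<mu> a \<Otimes>\<^sub>M \<mu> b) = UNIV"
        using sets_pair by (metis sets.sets_into_space UNIV_I top.extremum_uniqueI)
      then have "Pair x -` ((\<lambda>(x, y). x + y) -` {k} \<inter> space (\<mu> a \<Otimes>\<^sub>M \<mu> b)) = {k - x}"
        by (auto simp: algebra_simps)
      then show "emeasure (\<mu> b) (Pair x -` ((\<lambda>(x, y). x + y) -` {k} \<inter> space (\<mu> a \<Otimes>\<^sub>M \<mu> b)))
          = ennreal (mass \<mu> b (k - x))"
        by (simp add: mass[OF b])
    qed
    also have "\<dots> = nsum (\<lambda>x. ennreal (mass \<mu> a x) * ennreal (mass \<mu> b (k - x)))"
      unfolding convolution_semigroup_eq_point_measure[OF \<mu> a] point_measure_def
      by (subst nn_integral_density) auto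
    finally show "wt (Weights (\<lambda>k. ennreal (mass \<mu> a k)) * Weights (\<lambda>k. ennreal (mass \<mu> b k))) k
        = wt (Weights (\<lambda>k. ennreal (mass \<mu> (a + b) k))) k"
      by (simp add: wt_mult)
  qed
qed simp

text \<open>Repeating the displacement k gives positive weight to n k at time n T. Once n T exceeds
  a, \<open>F a\<close> is a factor of a nonzero product.\<close>

lemma (in lattice_semigroup) nonzero_of_point:
  assumes T: "0 < T" "wt (F T) k \<noteq> 0"
  shows "nonzero_lattice_semigroup F"
proof
  fix a :: real assume a: "0 < a"
  obtain n where n: "a / T < real n" using reals_Archimedean2 by blast
  then have nT: "a < real n * T" using T by (simp add: field_simps)
  then have n1: "n \<ge> 1" using a T by (cases n) auto
  have "wt (F T) k ^ n \<le> wt (F (real n * T)) (sum_list (replicate n k))"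
    using wt_power_ge[of "F T" k n] F_power[OF T(1) n1] by simp
  then have "wt (F (real n * T)) (sum_list (replicate n k)) \<noteq> 0" using T by auto
  moreover have "F a * F (real n * T - a) = F (real n * T)"
    using F_add[of a "real n * T - a"] a nT by simp
  ultimately have "wt (F a * F (real n * T - a)) (sum_list (replicate n k)) \<noteq> 0" by simp
  then show "\<exists>k. wt (F a) k \<noteq> 0"
    unfolding wt_mult by (rule contrapos_np) simp
qed

lemma inner_lattice_add: "inner_lattice c (x + y) = inner_lattice c x + inner_lattice c y"
  by (simp add: inner_lattice_def inner_vec_def algebra_simps sum.distrib)

text \<open>If the inner product of c and k is 0, the left side is \<open>mass \<mu> l k\<close>
  while the indicator annihilates the right side, hence the assumption that it is nonzero. The terms
  may have both signs, and \<open>infsum\<close> is 0 by convention on families that are not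
  summable; summability makes the right side a genuine sum.\<close>

theorem proposition7p3:
  fixes \<mu> :: "real \<Rightarrow> (int ^ 'n) measure"
    and c :: "real ^ 'n"
    and l :: real
    and k :: "int ^ 'n"
  assumes "convolution_semigroup \<mu>"
    and "l > 0"
    and "inner_lattice c k \<noteq> 0"
    and "(\<lambda>k'. p \<mu> k' l 0 * p \<mu> (k - k') (inner_lattice c k') c) summable_on UNIV"
  shows "p \<mu> k l c * indicat_real {0..} (inner_lattice c k) =
    (\<Sum>\<^sub>\<infinity>k'\<in>UNIV. p \<mu> k' l 0 * p \<mu> (k - k') (inner_lattice c k') c)"
proof -
  define t where "t = inner_lattice c k"
  define g where "g = (\<lambda>k'. p \<mu> k' l 0 * p \<mu> (k - k') (inner_lattice c k') c)"
  have split: "inner_lattice c k' + inner_lattice c (k - k') = t" for k'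
    using inner_lattice_add[of c k' "k - k'"] by (simp add: t_def)
  \<comment> \<open>By \<open>split\<close> the second factor lives at the same time t for every k',
    and its prefactor is linear in k'.\<close>
  have g: "g k' = inner_lattice c k' / t * (mass \<mu> l k' * mass \<mu> t (k - k')) * indicat_real {0<..} t" for k'
    using assms(2) by (simp add: g_def p_def split) (simp add: inner_lattice_def)
  show ?thesis
  proof (cases "0 < t")
    case False
    with assms(3) have "t < 0" by (simp add: t_def)
    then show ?thesis using g by (simp add: g_def[symmetric] t_def[symmetric] infsum_0)
  next
    case True
    interpret lattice_semigroup "\<lambda>a. Weights (\<lambda>k. ennreal (mass \<mu> a k))"
      by (rule lattice_semigroup_mass[OF assms(1)])
    have lhs: "p \<mu> k l c * indicat_real {0..} t = l / (l + t) * mass \<mu> (l + t) k"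
      using True assms(2) by (simp add: p_def t_def[symmetric])
    have "(g has_sum l / (l + t) * mass \<mu> (l + t) k) UNIV"
    \<comment> \<open>If the weight at the endpoint vanishes, so does each of the nonnegative
      products. Otherwise the semigroup is nonzero, as the structure theorem requires.\<close>
    proof (cases "mass \<mu> (l + t) k = 0")
      case zero: True
      have "mass \<mu> l k' * mass \<mu> t (k - k') = 0" for k'
        using wt_mult_ge[of "Weights (\<lambda>k. ennreal (mass \<mu> l k))" k' "Weights (\<lambda>k. ennreal (mass \<mu> t k))" "k - k'"]
          F_add[OF assms(2) True] zero by (simp add: ennreal_mult[symmetric] mass_def)
      then have "g = (\<lambda>_. 0)" by (auto simp: g)
      then show ?thesis using zero by simp
    next
      case False
      interpret nonzero_lattice_semigroup "\<lambda>a. Weights (\<lambda>k. ennreal (mass \<mu> a k))"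
      proof (rule nonzero_of_point)
        show "0 < l + t" using assms(2) True by simp
        show "wt (Weights (\<lambda>k. ennreal (mass \<mu> (l + t) k))) k \<noteq> 0"
          using False by (simp add: mass_def ennreal_eq_0_iff measure_le_0_iff)
      qed
      have f: "f a x = mass \<mu> a x" for a x
        unfolding f_def by (simp add: mass_def)
      have g': "g = (\<lambda>k'. 1 / t * (inner_lattice c k' * (f l k' * f t (k - k'))))"
        using True by (auto simp: g f)
      have "(\<lambda>k'. inner_lattice c k' * (f l k' * f t (k - k'))) summable_on UNIV"
        using assms(4) True unfolding g_def[symmetric] g' by (simp add: summable_on_cmult_right' del: times_divide_eq_left)
      from bridge_moment[OF assms(2) True inner_lattice_add this]
      have "((\<lambda>k'. inner_lattice c k' * (f l k' * f t (k - k'))) has_sum l / (l + t) * t * mass \<mu> (l + t) k) UNIV"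
        by (simp add: f t_def)
      from has_sum_cmult_right[OF this, of "1 / t"] show ?thesis
        using True by (simp add: g' mult.assoc)
    qed
    then show ?thesis using lhs by (simp add: g_def[symmetric] t_def[symmetric] infsumI)
  qed
qed

end
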